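(* Let $d\ge2$ be an integer, let $|\cdot|$ be a norm on $\mathbb{R}^d$, and let $\mu$ and $\nu$ be two probability measures on $([0,1]^d,\mathcal{B}or([0,1]^d))$. Then $$\mathcal{W}_1(\mu,\nu)\le\mathfrak{d}_d\,2^{-\frac1d}\left(\frac{3(d-1)}{2(1-2^{1-d})}\right)^{\frac1d}\frac{2d}{d-1}\,D^{\infty}(\mu,\nu)^{\frac1d}.$$ In particular, $$\mathcal{W}_1(\mu,\nu)\le\mathfrak{d}_d\,\kappa_d\,D^{\star}(\mu,\nu)^{\frac1d}\quad\text{with}\quad\kappa_d=2^{1-\frac1d}\left(\frac{3(d-1)}{2(1-2^{1-d})}\right)^{\frac1d}\frac{2d}{d-1}.$$
   Context: $\mathcal{W}_1$ denotes the $1$-Wasserstein distance associated with the norm $|\cdot|$: $\mathcal{W}_1(\mu,\nu)=\inf\{\mathbb{E}|X-Y|: X\sim\mu,\ Y\sim\nu\}$. $\mathfrak{d}_d=\sup_{x,y\in(0,1]^d}|y-x|$. For $x,y\in[0,1]^d$, $[x,y]=\prod_{i=1}^d[x^i,y^i]$ if $x^i\le y^i$ for all $i$, and $[x,y]=\varnothing$ otherwise. The uniform discrepancy is $D^{\infty}(\mu,\nu)=\sup_{x,y\in[0,1]^d}|\mu([x,y])-\nu([x,y])|$ and the star discrepancy is $D^{\star}(\mu,\nu)=\sup_{x\in[0,1]^d}|\mu([0,x])-\nu([0,x])|$. *)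

theory Defs
  imports "HOL-Probability.Probability"
begin

definition is_norm :: "('a::real_vector \<Rightarrow> real) \<Rightarrow> bool" where
  "is_norm N \<longleftrightarrow>
     (\<forall>x. 0 \<le> N x) \<and> (\<forall>x. N x = 0 \<longleftrightarrow> x = 0) \<and>
     (\<forall>c x. N (c *\<^sub>R x) = \<bar>c\<bar> * N x) \<and>
     (\<forall>x y. N (x + y) \<le> N x + N y)"

(* The order on real ^ 'n is componentwise, and 0, 1 are the constant vectors. Hence {x..y} is
   the box [x,y] (empty unless x \<le> y componentwise), and {0..1} is the unit cube. *)

definition prob_on_cube :: "(real ^ 'n) measure \<Rightarrow> bool" where
  "prob_on_cube \<mu> \<longleftrightarrow>
     prob_space \<mu> \<and> sets \<mu> = sets (restrict_space borel {0..1 :: real ^ 'n})"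

(* X and Y range over pairs of random variables on a common probability space \<Omega>. The points
   of \<Omega> are taken in 'a \<times> 'a, since HOL cannot quantify over types inside a
   definition; this loses nothing, as X and Y can be replaced by the coordinate projections
   under their joint law. The expectation is the [0,\<infinity>]-valued integral. *)
definition wasserstein1 ::
    "('a::real_normed_vector \<Rightarrow> real) \<Rightarrow> 'a measure \<Rightarrow> 'a measure \<Rightarrow> ennreal" where
  "wasserstein1 N \<mu> \<nu> =
     Inf {(\<integral>\<^sup>+ \<omega>. ennreal (N (X \<omega> - Y \<omega>)) \<partial>\<Omega>) | (\<Omega> :: ('a \<times> 'a) measure) X Y.
            prob_space \<Omega> \<and>
            X \<in> measurable \<Omega> \<mu> \<and> distr \<Omega> \<mu> X = \<mu> \<and>
            Y \<in> measurable \<Omega> \<nu> \<and> distr \<Omega> \<nu> Y = \<nu>}"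

definition cube_diam :: "(real ^ 'n \<Rightarrow> real) \<Rightarrow> real" where
  "cube_diam N =
     Sup {N (y - x) | x y. (\<forall>i. x $ i \<in> {0<..1}) \<and> (\<forall>i. y $ i \<in> {0<..1})}"

definition unif_discrepancy :: "(real ^ 'n) measure \<Rightarrow> (real ^ 'n) measure \<Rightarrow> real" where
  "unif_discrepancy \<mu> \<nu> =
     Sup {\<bar>measure \<mu> {x..y} - measure \<nu> {x..y}\<bar> | x y. x \<in> {0..1} \<and> y \<in> {0..1}}"

definition star_discrepancy :: "(real ^ 'n) measure \<Rightarrow> (real ^ 'n) measure \<Rightarrow> real" where
  "star_discrepancy \<mu> \<nu> =
     Sup {\<bar>measure \<mu> {0..x} - measure \<nu> {0..x}\<bar> | x. x \<in> {0..1}}"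

definition kappa :: "nat \<Rightarrow> real" where
  "kappa d =
     2 powr (1 - 1 / real d)
     * (3 * (real d - 1) / (2 * (1 - 2 powr (1 - real d)))) powr (1 / real d)
     * (2 * real d / (real d - 1))"

end

theory Submission
  imports Defs
begin

text \<open>Cut the cube into dyadic cells at levels \<open>0, \<dots>, L\<close> and couple the two measures greedily, matching
  as much mass as possible inside the finest cells, then inside their parents, and so on. The mass
  that is not matched within cells of level \<open>k\<close> is half the sum of \<open>\<bar>\<mu>(F) - \<nu>(F)\<bar>\<close> over these
  cells, hence at most \<open>2\<^sup>d\<^sup>k D / 2\<close>, and mass matched at level \<open>k\<close> travels at most \<open>2\<^sup>-\<^sup>k\<close> times the
  diameter. Summing over the levels bounds the cost by the diameter times
  \<open>u + D u\<^sup>1\<^sup>-\<^sup>d / (2 (1 - 2\<^sup>1\<^sup>-\<^sup>d))\<close> with \<open>u = 2\<^sup>-\<^sup>L\<close>; it remains to take \<open>u\<close> within a factor two above the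
  minimiser \<open>w\<close>. The star discrepancy enters because a box is a signed combination of \<open>2\<^sup>d\<close> boxes
  anchored at the origin.\<close>

section \<open>Simultaneously optimal matchings on a hierarchy of partitions\<close>

lemma sum_fibre_fibres:
  fixes c :: "'i \<Rightarrow> 'i \<Rightarrow> real"
  assumes "finite I" and supp: "\<And>i j. c i j \<noteq> 0 \<Longrightarrow> f i = f j"
  shows "(\<Sum>i | i \<in> I \<and> f i = g. \<Sum>j\<in>I. c i j) = (\<Sum>i | i \<in> I \<and> f i = g. \<Sum>j | j \<in> I \<and> f j = g. c i j)"
  using assms by (intro sum.cong refl sum.mono_neutral_right) auto

text \<open>Inside each cell the residual masses left by \<open>c\<close> are matched by a
  normalised product: its total is the smaller residual, and its marginals stay below the residuals.
  As \<open>c\<close> itself never crosses cells, old and new mass together reach the best possible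
  value in every cell.\<close>

lemma matching_step:
  fixes f :: "'i \<Rightarrow> 'k" and p q :: "'i \<Rightarrow> real" and c :: "'i \<Rightarrow> 'i \<Rightarrow> real"
  assumes fin: "finite I"
    and c0: "\<And>i j. 0 \<le> c i j"
    and supp: "\<And>i j. c i j \<noteq> 0 \<Longrightarrow> i \<in> I \<and> j \<in> I \<and> f i = f j"
    and row: "\<And>i. i \<in> I \<Longrightarrow> (\<Sum>j\<in>I. c i j) \<le> p i"
    and col: "\<And>j. j \<in> I \<Longrightarrow> (\<Sum>i\<in>I. c i j) \<le> q j"
  obtains c' where "\<And>i j. c i j \<le> c' i j"
    and "\<And>i j. c' i j \<noteq> 0 \<Longrightarrow> i \<in> I \<and> j \<in> I \<and> f i = f j"
    and "\<And>i. i \<in> I \<Longrightarrow> (\<Sum>j\<in>I. c' i j) \<le> p i"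
    and "\<And>j. j \<in> I \<Longrightarrow> (\<Sum>i\<in>I. c' i j) \<le> q j"
    and "\<And>g. (\<Sum>i | i \<in> I \<and> f i = g. \<Sum>j | j \<in> I \<and> f j = g. c' i j)
          = min (\<Sum>i | i \<in> I \<and> f i = g. p i) (\<Sum>i | i \<in> I \<and> f i = g. q i)"
proof -
  define r where "r i = p i - (\<Sum>j\<in>I. c i j)" for i
  define s where "s j = q j - (\<Sum>i\<in>I. c i j)" for j
  define R where "R g = (\<Sum>i | i \<in> I \<and> f i = g. r i)" for g
  define S where "S g = (\<Sum>i | i \<in> I \<and> f i = g. s i)" for g
  \<comment> \<open>With the larger residual total as denominator, both marginals are dominated. If
    both totals vanish, division by zero yields 0, which is still the right value.\<close>
  define inc where "inc i j = (if i \<in> I \<and> j \<in> I \<and> f i = f j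
      then r i * s j / max (R (f i)) (S (f i)) else 0)" for i j
  have r0: "0 \<le> r i" and s0: "0 \<le> s i" if "i \<in> I" for i
    using row[OF that] col[OF that] by (auto simp: r_def s_def)
  have R0: "0 \<le> R g" and S0: "0 \<le> S g" for g
    unfolding R_def S_def by (auto intro!: sum_nonneg r0 s0)
  have inc0: "0 \<le> inc i j" for i j
    using R0 S0 r0 s0 by (auto simp: inc_def le_max_iff_disj)
  have shrink: "a * b / max b' b \<le> a" "a * b / max b b' \<le> a" if "0 \<le> a" "0 \<le> b" for a b b' :: real
    using that mult_left_mono[of b "max b' b" a] mult_left_mono[of b "max b b'" a]
    by (auto simp: divide_le_eq max_def)
  have inc_row: "(\<Sum>j\<in>I. inc i j) \<le> r i" if i: "i \<in> I" for i
  proof -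
    have "(\<Sum>j\<in>I. inc i j) = (\<Sum>j | j \<in> I \<and> f j = f i. r i * s j / max (R (f i)) (S (f i)))"
      by (intro sum.mono_neutral_cong_right) (auto simp: fin inc_def i)
    also have "\<dots> = r i * S (f i) / max (R (f i)) (S (f i))"
      by (simp add: S_def sum_distrib_left sum_divide_distrib)
    finally show ?thesis
      using shrink[OF r0[OF i] S0] by metis
  qed
  have inc_col: "(\<Sum>i\<in>I. inc i j) \<le> s j" if j: "j \<in> I" for j
  proof -
    have "(\<Sum>i\<in>I. inc i j) = (\<Sum>i | i \<in> I \<and> f i = f j. s j * r i / max (R (f j)) (S (f j)))"
      by (intro sum.mono_neutral_cong_right) (auto simp: fin inc_def j)
    also have "\<dots> = s j * R (f j) / max (R (f j)) (S (f j))"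
      by (simp add: R_def sum_distrib_left sum_divide_distrib)
    finally show ?thesis
      using shrink[OF s0[OF j] R0] by metis
  qed
  have inc_cell: "(\<Sum>i | i \<in> I \<and> f i = g. \<Sum>j | j \<in> I \<and> f j = g. inc i j) = min (R g) (S g)" for g
  proof -
    have "(\<Sum>i | i \<in> I \<and> f i = g. \<Sum>j | j \<in> I \<and> f j = g. inc i j)
       = (\<Sum>i | i \<in> I \<and> f i = g. \<Sum>j | j \<in> I \<and> f j = g. r i * s j / max (R g) (S g))"
      by (intro sum.cong refl) (auto simp: inc_def)
    also have "\<dots> = R g * S g / max (R g) (S g)"
      by (simp add: R_def S_def sum_product sum_divide_distrib)
    also have "\<dots> = min (R g) (S g)"
      using R0[of g] S0[of g] by (auto simp: min_def max_def)
    finally show ?thesis .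
  qed
  \<comment> \<open>Column sums over a cell add up to the same mass as row sums, because
    \<open>c\<close> stays inside cells. Hence \<open>R\<close> and \<open>S\<close> subtract the
    same amount t, and t + min(P - t, Q - t) = min(P, Q).\<close>
  have swap: "(\<Sum>i | i \<in> I \<and> f i = g. \<Sum>j\<in>I. c j i) = (\<Sum>i | i \<in> I \<and> f i = g. \<Sum>j | j \<in> I \<and> f j = g. c i j)" for g
    by (subst sum_fibre_fibres[OF fin, of "\<lambda>i j. c j i"]) (use supp in \<open>auto intro: sum.swap dest: sym\<close>)
  show thesis
  proof (rule that[of "\<lambda>i j. c i j + inc i j"])
    fix g
    have "R g = (\<Sum>i | i \<in> I \<and> f i = g. p i) - (\<Sum>i | i \<in> I \<and> f i = g. \<Sum>j | j \<in> I \<and> f j = g. c i j)"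
      unfolding R_def r_def sum_subtractf by (subst sum_fibre_fibres[OF fin]) (use supp in auto)
    moreover have "S g = (\<Sum>i | i \<in> I \<and> f i = g. q i) - (\<Sum>i | i \<in> I \<and> f i = g. \<Sum>j | j \<in> I \<and> f j = g. c i j)"
      unfolding S_def s_def sum_subtractf swap ..
    ultimately show "(\<Sum>i | i \<in> I \<and> f i = g. \<Sum>j | j \<in> I \<and> f j = g. c i j + inc i j)
        = min (\<Sum>i | i \<in> I \<and> f i = g. p i) (\<Sum>i | i \<in> I \<and> f i = g. q i)"
      by (simp add: sum.distrib inc_cell min_def)
  next
    fix i j show "c i j + inc i j \<noteq> 0 \<Longrightarrow> i \<in> I \<and> j \<in> I \<and> f i = f j"
      using supp[of i j] by (auto simp: inc_def split: if_splits)
  next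
    fix i assume "i \<in> I"
    then show "(\<Sum>j\<in>I. c i j + inc i j) \<le> p i"
      using inc_row[of i] by (simp add: sum.distrib r_def)
  next
    fix i assume "i \<in> I"
    then show "(\<Sum>j\<in>I. c j i + inc j i) \<le> q i"
      using inc_col[of i] by (simp add: sum.distrib s_def)
  qed (simp add: inc0)
qed

text \<open>Matching greedily from the finest partition to the coarsest never undoes earlier matches,
  so the result is optimal for every partition of the hierarchy simultaneously.\<close>

lemma hierarchical_matching:
  fixes e :: "nat \<Rightarrow> 'i \<Rightarrow> 'k" and p q :: "'i \<Rightarrow> real"
  assumes fin: "finite I"
    and p0: "\<And>i. i \<in> I \<Longrightarrow> 0 \<le> p i" and q0: "\<And>i. i \<in> I \<Longrightarrow> 0 \<le> q i"
    and coarser: "\<And>m i j. e m i = e m j \<Longrightarrow> e (Suc m) i = e (Suc m) j"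
  shows "\<exists>c. (\<forall>i j. 0 \<le> c i j)
    \<and> (\<forall>i j. c i j \<noteq> 0 \<longrightarrow> i \<in> I \<and> j \<in> I \<and> e n i = e n j)
    \<and> (\<forall>i\<in>I. (\<Sum>j\<in>I. c i j) \<le> p i) \<and> (\<forall>j\<in>I. (\<Sum>i\<in>I. c i j) \<le> q j)
    \<and> (\<forall>m<n. \<forall>g. min (\<Sum>i | i \<in> I \<and> e m i = g. p i) (\<Sum>i | i \<in> I \<and> e m i = g. q i)
          \<le> (\<Sum>i | i \<in> I \<and> e m i = g. \<Sum>j | j \<in> I \<and> e m j = g. c i j))"
proof (induction n)
  case 0
  show ?case by (rule exI[of _ "\<lambda>_ _. 0"]) (simp add: p0 q0)
next
  case (Suc n)
  then obtain c where c: "\<And>i j. 0 \<le> c i j"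
      "\<And>i j. c i j \<noteq> 0 \<Longrightarrow> i \<in> I \<and> j \<in> I \<and> e n i = e n j"
      "\<And>i. i \<in> I \<Longrightarrow> (\<Sum>j\<in>I. c i j) \<le> p i" "\<And>j. j \<in> I \<Longrightarrow> (\<Sum>i\<in>I. c i j) \<le> q j"
    and opt: "\<And>m g. m < n \<Longrightarrow> min (\<Sum>i | i \<in> I \<and> e m i = g. p i) (\<Sum>i | i \<in> I \<and> e m i = g. q i)
          \<le> (\<Sum>i | i \<in> I \<and> e m i = g. \<Sum>j | j \<in> I \<and> e m j = g. c i j)"
    by blast
  obtain c' where c': "\<And>i j. c i j \<le> c' i j"
      "\<And>i j. c' i j \<noteq> 0 \<Longrightarrow> i \<in> I \<and> j \<in> I \<and> e n i = e n j"
      "\<And>i. i \<in> I \<Longrightarrow> (\<Sum>j\<in>I. c' i j) \<le> p i" "\<And>j. j \<in> I \<Longrightarrow> (\<Sum>i\<in>I. c' i j) \<le> q j"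
      "\<And>g. (\<Sum>i | i \<in> I \<and> e n i = g. \<Sum>j | j \<in> I \<and> e n j = g. c' i j)
          = min (\<Sum>i | i \<in> I \<and> e n i = g. p i) (\<Sum>i | i \<in> I \<and> e n i = g. q i)"
    by (rule matching_step[where f = "e n" and c = c and p = p and q = q, OF fin c]) blast+
  have "min (\<Sum>i | i \<in> I \<and> e m i = g. p i) (\<Sum>i | i \<in> I \<and> e m i = g. q i)
          \<le> (\<Sum>i | i \<in> I \<and> e m i = g. \<Sum>j | j \<in> I \<and> e m j = g. c' i j)" if "m < Suc n" for m g
  proof (cases "m = n")
    \<comment> \<open>Optimality at finer levels survives because mass is only added:
      \<open>c\<close> lies below \<open>c'\<close> pointwise.\<close>
    case False
    with that have "m < n" by simp
    then show ?thesis
      by (rule order_trans[OF opt]) (auto intro!: sum_mono c')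
  qed (simp add: c'(5))
  moreover have "0 \<le> c' i j" for i j
    using c(1) c'(1) order_trans by blast
  \<comment> \<open>\<open>coarser\<close> widens the support condition from cells of
    \<open>e n\<close> to cells of \<open>e (Suc n)\<close>, which restores the invariant of the
    induction.\<close>
  ultimately show ?case
    by (intro exI[of _ c']) (use c' coarser in blast)
qed

text \<open>Equal totals and a one-cell level \<open>n\<close> force the greedy matching to exhaust
  all mass, so it is a true coupling. Its mass crossing cells of level \<open>m\<close> is at most
  the total minus the sum of the cellwise minima, and min(a, b) = (a + b - |a - b|) / 2.\<close>

lemma hierarchical_coupling:
  fixes e :: "nat \<Rightarrow> 'i \<Rightarrow> 'k" and p q :: "'i \<Rightarrow> real"
  assumes fin: "finite I"
    and p0: "\<And>i. i \<in> I \<Longrightarrow> 0 \<le> p i" and q0: "\<And>i. i \<in> I \<Longrightarrow> 0 \<le> q i"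
    and coarser: "\<And>m i j. e m i = e m j \<Longrightarrow> e (Suc m) i = e (Suc m) j"
    and trivial: "\<And>i j. i \<in> I \<Longrightarrow> j \<in> I \<Longrightarrow> e n i = e n j"
    and total: "sum p I = sum q I"
  obtains c where "\<And>i j. 0 \<le> c i j"
    and "\<And>i. i \<in> I \<Longrightarrow> (\<Sum>j\<in>I. c i j) = p i" and "\<And>j. j \<in> I \<Longrightarrow> (\<Sum>i\<in>I. c i j) = q j"
    and "\<And>m. m \<le> n \<Longrightarrow> (\<Sum>i\<in>I. \<Sum>j\<in>I. c i j * of_bool (e m i \<noteq> e m j))
       \<le> (\<Sum>g\<in>e m ` I. \<bar>(\<Sum>i | i \<in> I \<and> e m i = g. p i) - (\<Sum>i | i \<in> I \<and> e m i = g. q i)\<bar>) / 2"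
proof -
  \<comment> \<open>The trivial level \<open>n\<close> must itself be among the optimal ones, hence
    the instance \<open>Suc n\<close>.\<close>
  obtain c where c0: "\<And>i j. 0 \<le> c i j"
    and row: "\<And>i. i \<in> I \<Longrightarrow> (\<Sum>j\<in>I. c i j) \<le> p i" and col: "\<And>j. j \<in> I \<Longrightarrow> (\<Sum>i\<in>I. c i j) \<le> q j"
    and opt: "\<And>m g. m < Suc n \<Longrightarrow> min (\<Sum>i | i \<in> I \<and> e m i = g. p i) (\<Sum>i | i \<in> I \<and> e m i = g. q i)
          \<le> (\<Sum>i | i \<in> I \<and> e m i = g. \<Sum>j | j \<in> I \<and> e m j = g. c i j)"
    using hierarchical_matching[where e = e and p = p and q = q and n = "Suc n", OF fin p0 q0 coarser]
    by blast
  have tot: "sum p I \<le> (\<Sum>i\<in>I. \<Sum>j\<in>I. c i j)"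
  proof (cases "I = {}")
    case False
    then obtain i where "i \<in> I" by blast
    then have "{j \<in> I. e n j = e n i} = I" by (auto intro: trivial)
    with opt[of n "e n i"] total show ?thesis by simp
  qed simp
  \<comment> \<open>Termwise inequalities whose sums agree are equalities.\<close>
  have row': "(\<Sum>j\<in>I. c i j) = p i" if "i \<in> I" for i
    by (rule sum_mono_inv[OF antisym[OF sum_mono[OF row] tot] row that fin])
  have tot': "sum q I \<le> (\<Sum>j\<in>I. \<Sum>i\<in>I. c i j)"
    using tot total by (subst sum.swap) simp
  have col': "(\<Sum>i\<in>I. c i j) = q j" if "j \<in> I" for j
    by (rule sum_mono_inv[OF antisym[OF sum_mono[OF col] tot'] col that fin])
  show thesis
  proof (rule that[OF c0 row' col'])
    fix m assume "m \<le> n"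
    define P Q where "P g = (\<Sum>i | i \<in> I \<and> e m i = g. p i)"
      and "Q g = (\<Sum>i | i \<in> I \<and> e m i = g. q i)" for g
    have P: "sum P (e m ` I) = sum p I" and Q: "sum Q (e m ` I) = sum q I"
      unfolding P_def Q_def by (rule sum.image_gen[OF fin, symmetric])+
    have "(\<Sum>g\<in>e m ` I. min (P g) (Q g))
        \<le> (\<Sum>g\<in>e m ` I. \<Sum>i | i \<in> I \<and> e m i = g. \<Sum>j | j \<in> I \<and> e m j = g. c i j)"
      unfolding P_def Q_def using \<open>m \<le> n\<close> by (intro sum_mono opt) simp
    also have "\<dots> = (\<Sum>g\<in>e m ` I. \<Sum>i | i \<in> I \<and> e m i = g. \<Sum>j\<in>I. c i j * of_bool (e m i = e m j))"
      by (intro sum.cong refl sum.mono_neutral_cong_left) (auto simp: fin)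
    also have "\<dots> = (\<Sum>i\<in>I. \<Sum>j\<in>I. c i j * of_bool (e m i = e m j))"
      by (rule sum.image_gen[OF fin, symmetric])
    also have "\<dots> = (\<Sum>i\<in>I. \<Sum>j\<in>I. c i j) - (\<Sum>i\<in>I. \<Sum>j\<in>I. c i j * of_bool (e m i \<noteq> e m j))"
      unfolding sum_subtractf[symmetric] by (intro sum.cong refl) auto
    also have "(\<Sum>i\<in>I. \<Sum>j\<in>I. c i j) = sum p I"
      using row' by simp
    finally have "(\<Sum>i\<in>I. \<Sum>j\<in>I. c i j * of_bool (e m i \<noteq> e m j)) \<le> sum p I - (\<Sum>g\<in>e m ` I. min (P g) (Q g))"
      by simp
    also have "(\<Sum>g\<in>e m ` I. min (P g) (Q g)) = (\<Sum>g\<in>e m ` I. (P g + Q g - \<bar>P g - Q g\<bar>) / 2)"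
      by (intro sum.cong refl) (auto simp: min_def)
    also have "\<dots> = sum p I - (\<Sum>g\<in>e m ` I. \<bar>P g - Q g\<bar>) / 2"
      using P Q total by (simp add: sum_divide_distrib[symmetric] sum_subtractf sum.distrib)
    finally show "(\<Sum>i\<in>I. \<Sum>j\<in>I. c i j * of_bool (e m i \<noteq> e m j)) \<le> (\<Sum>g\<in>e m ` I. \<bar>P g - Q g\<bar>) / 2"
      by simp
  qed
qed

section \<open>Lifting a discrete coupling\<close>

lemma nn_integral_finite_valued:
  assumes K: "K \<in> measurable M (count_space I)" and fin: "finite I"
  shows "(\<integral>\<^sup>+x. h (K x) \<partial>M) = (\<Sum>i\<in>I. h i * emeasure M (K -` {i} \<inter> space M))"
proof -
  have "(\<integral>\<^sup>+x. h (K x) \<partial>M) = (\<integral>\<^sup>+x. (\<Sum>i\<in>I. h i * indicator (K -` {i} \<inter> space M) x) \<partial>M)"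
  proof (intro nn_integral_cong)
    fix x assume x: "x \<in> space M"
    with K have "K x \<in> I" by (auto dest: measurable_space)
    moreover have "h i * indicator (K -` {i} \<inter> space M) x = (if K x = i then h i else 0)" for i
      using x by (auto simp: indicator_def)
    ultimately show "h (K x) = (\<Sum>i\<in>I. h i * indicator (K -` {i} \<inter> space M) x)"
      using fin by simp
  qed
  also have "\<dots> = (\<Sum>i\<in>I. \<integral>\<^sup>+x. h i * indicator (K -` {i} \<inter> space M) x \<partial>M)"
    by (intro nn_integral_sum borel_measurable_times_ennreal borel_measurable_const
        borel_measurable_indicator measurable_sets[OF K]) simp
  also have "\<dots> = (\<Sum>i\<in>I. h i * emeasure M (K -` {i} \<inter> space M))"
    using K by (intro sum.cong refl nn_integral_cmult_indicator) (auto intro!: measurable_sets)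
  finally show ?thesis .
qed

text \<open>Finitely many null fibres have a null union; this later permits division by the mass of
  the fibre through a point.\<close>

lemma AE_fibre_nonnull:
  assumes K: "K \<in> measurable M (count_space I)" and fin: "finite I"
  shows "AE x in M. emeasure M (K -` {K x} \<inter> space M) \<noteq> 0"
proof -
  have "AE x in M. \<forall>i\<in>I. emeasure M (K -` {i} \<inter> space M) = 0 \<longrightarrow> K x \<noteq> i"
    using fin
  proof (intro AE_finite_allI)
    fix i assume i: "i \<in> I"
    show "AE x in M. emeasure M (K -` {i} \<inter> space M) = 0 \<longrightarrow> K x \<noteq> i"
    proof (cases "emeasure M (K -` {i} \<inter> space M) = 0")
      case True
      with i measurable_sets[OF K, of "{i}"] have "AE x in M. x \<notin> K -` {i} \<inter> space M"
        by (intro AE_not_in) (auto simp: null_sets_def)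
      with AE_space show ?thesis by eventually_elim auto
    qed simp
  qed
  with AE_space show ?thesis
  proof eventually_elim
    fix x assume "x \<in> space M" "\<forall>i\<in>I. emeasure M (K -` {i} \<inter> space M) = 0 \<longrightarrow> K x \<noteq> i"
    then show "emeasure M (K -` {K x} \<inter> space M) \<noteq> 0"
      using measurable_space[OF K, of x] by auto
  qed
qed

text \<open>Spread the mass \<open>c i j\<close> over the fibres of \<open>i\<close> and \<open>j\<close> as a multiple of the product measure.\<close>

lemma coupling_lift:
  fixes K :: "'a \<Rightarrow> 'i" and c :: "'i \<Rightarrow> 'i \<Rightarrow> real"
  assumes "prob_space M" and "prob_space M'"
    and K: "K \<in> measurable M (count_space I)" and K': "K' \<in> measurable M' (count_space I)"
    and fin: "finite I" and c0: "\<And>i j. 0 \<le> c i j"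
    and row: "\<And>i. i \<in> I \<Longrightarrow> (\<Sum>j\<in>I. c i j) = measure M (K -` {i} \<inter> space M)"
    and col: "\<And>j. j \<in> I \<Longrightarrow> (\<Sum>i\<in>I. c i j) = measure M' (K' -` {j} \<inter> space M')"
  obtains \<Omega> where "prob_space \<Omega>" and "sets \<Omega> = sets (M \<Otimes>\<^sub>M M')"
    and "distr \<Omega> M fst = M" and "distr \<Omega> M' snd = M'"
    and "\<And>\<phi>. (\<integral>\<^sup>+\<omega>. \<phi> (K (fst \<omega>)) (K' (snd \<omega>)) \<partial>\<Omega>) = (\<Sum>i\<in>I. \<Sum>j\<in>I. \<phi> i j * ennreal (c i j))"
proof -
  interpret M: prob_space M by fact
  interpret M': prob_space M' by fact
  interpret pair_prob_space M M' ..
  define p where "p i = measure M (K -` {i} \<inter> space M)" for i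
  define q where "q j = measure M' (K' -` {j} \<inter> space M')" for j
  have p0: "0 \<le> p i" and q0: "0 \<le> q i" for i by (auto simp: p_def q_def)
  \<comment> \<open>A fibre without mass carries no coupled mass, so the quotient 0 / 0 = 0 in
    \<open>w\<close> is harmless.\<close>
  have cp: "c i j = 0" if "p i = 0" "i \<in> I" "j \<in> I" for i j
    using that row[of i] c0 fin by (simp add: p_def sum_nonneg_eq_0_iff)
  have cq: "c i j = 0" if "q j = 0" "i \<in> I" "j \<in> I" for i j
    using that col[of j] c0 fin by (simp add: q_def sum_nonneg_eq_0_iff)
  \<comment> \<open>On the product of the fibres of \<open>i\<close> and \<open>j\<close>, which has
    product mass \<open>p i * q j\<close>, this density yields mass \<open>c i j\<close>.\<close>
  define w where "w i j = c i j / (p i * q j)" for i j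
  have w0: "0 \<le> w i j" for i j using c0 p0 q0 by (simp add: w_def)
  have [measurable]: "(\<lambda>\<omega>. K (fst \<omega>)) \<in> measurable (M \<Otimes>\<^sub>M M') (count_space I)"
      "(\<lambda>\<omega>. K' (snd \<omega>)) \<in> measurable (M \<Otimes>\<^sub>M M') (count_space I)"
    using K K' by measurable
  \<comment> \<open>Pairs of labels live in a finite discrete space, so measurability of any
    function of the labels is automatic.\<close>
  have KK': "(\<lambda>\<omega>. (K (fst \<omega>), K' (snd \<omega>))) \<in> measurable (M \<Otimes>\<^sub>M M') (count_space (I \<times> I))"
    using fin by (subst pair_measure_countable[symmetric]) (auto intro: countable_finite)
  have meas: "(\<lambda>\<omega>. \<phi> (K (fst \<omega>)) (K' (snd \<omega>))) \<in> borel_measurable (M \<Otimes>\<^sub>M M')" for \<phi> :: "'i \<Rightarrow> 'i \<Rightarrow> ennreal"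
    using measurable_compose[OF KK', of "\<lambda>(i, j). \<phi> i j" borel] by simp
  have [measurable]: "(\<lambda>\<omega>. ennreal (w (K (fst \<omega>)) (K' (snd \<omega>)))) \<in> borel_measurable (M \<Otimes>\<^sub>M M')"
    by (rule meas)
  define \<Omega> where "\<Omega> = density (M \<Otimes>\<^sub>M M') (\<lambda>\<omega>. ennreal (w (K (fst \<omega>)) (K' (snd \<omega>))))"
  \<comment> \<open>On a non-null fibre the density integrates to one in the second variable: this
    is the row condition divided by \<open>p i\<close>.\<close>
  have inner1: "(\<integral>\<^sup>+y. ennreal (w i (K' y)) \<partial>M') = 1" if "i \<in> I" "p i \<noteq> 0" for i
  proof -
    have "(\<integral>\<^sup>+y. ennreal (w i (K' y)) \<partial>M') = (\<Sum>j\<in>I. ennreal (w i j) * ennreal (q j))"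
      by (simp add: nn_integral_finite_valued[OF K' fin, of "\<lambda>j. ennreal (w i j)"] q_def M'.emeasure_eq_measure)
    also have "\<dots> = (\<Sum>j\<in>I. ennreal (c i j / p i))"
      by (intro sum.cong refl) (use cq that in \<open>auto simp: w_def ennreal_mult''[symmetric] q0\<close>)
    also have "\<dots> = 1"
      using row[of i] that c0 p0
      by (simp add: sum_ennreal sum_divide_distrib[symmetric] p_def)
    finally show ?thesis .
  qed
  have inner2: "(\<integral>\<^sup>+x. ennreal (w (K x) j) \<partial>M) = 1" if "j \<in> I" "q j \<noteq> 0" for j
  proof -
    have "(\<integral>\<^sup>+x. ennreal (w (K x) j) \<partial>M) = (\<Sum>i\<in>I. ennreal (w i j) * ennreal (p i))"
      by (simp add: nn_integral_finite_valued[OF K fin, of "\<lambda>i. ennreal (w i j)"] p_def M.emeasure_eq_measure)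
    also have "\<dots> = (\<Sum>i\<in>I. ennreal (c i j / q j))"
      by (intro sum.cong refl) (use cp that in \<open>auto simp: w_def ennreal_mult''[symmetric] p0\<close>)
    also have "\<dots> = 1"
      using col[of j] that c0 q0
      by (simp add: sum_ennreal sum_divide_distrib[symmetric] q_def)
    finally show ?thesis .
  qed
  have ae1: "AE x in M. p (K x) \<noteq> 0"
    using AE_fibre_nonnull[OF K fin] by (simp add: p_def M.emeasure_eq_measure)
  have ae2: "AE y in M'. q (K' y) \<noteq> 0"
    using AE_fibre_nonnull[OF K' fin] by (simp add: q_def M'.emeasure_eq_measure)
  have d1: "distr \<Omega> M fst = M"
  proof (rule measure_eqI)
    fix A assume "A \<in> sets (distr \<Omega> M fst)"
    then have A[measurable]: "A \<in> sets M" by simp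
    have "emeasure (distr \<Omega> M fst) A = emeasure \<Omega> (fst -` A \<inter> space (M \<Otimes>\<^sub>M M'))"
      by (subst emeasure_distr) (auto simp: \<Omega>_def)
    also have "\<dots> = (\<integral>\<^sup>+\<omega>. ennreal (w (K (fst \<omega>)) (K' (snd \<omega>))) * indicator (fst -` A \<inter> space (M \<Otimes>\<^sub>M M')) \<omega> \<partial>(M \<Otimes>\<^sub>M M'))"
      unfolding \<Omega>_def by (subst emeasure_density) auto
    also have "\<dots> = (\<integral>\<^sup>+\<omega>. ennreal (w (K (fst \<omega>)) (K' (snd \<omega>))) * indicator A (fst \<omega>) \<partial>(M \<Otimes>\<^sub>M M'))"
      by (intro nn_integral_cong) (auto simp: indicator_def)
    also have "\<dots> = (\<integral>\<^sup>+x. \<integral>\<^sup>+y. ennreal (w (K x) (K' y)) * indicator A x \<partial>M' \<partial>M)"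
      by (subst M'.nn_integral_fst[symmetric]) auto
    also have "\<dots> = (\<integral>\<^sup>+x. indicator A x \<partial>M)"
    proof (rule nn_integral_cong_AE, use ae1 AE_space in eventually_elim)
      fix x assume x: "p (K x) \<noteq> 0" "x \<in> space M"
      with K have "K x \<in> I" by (auto dest: measurable_space)
      with x inner1[of "K x"] show "(\<integral>\<^sup>+y. ennreal (w (K x) (K' y)) * indicator A x \<partial>M') = indicator A x"
        by (simp add: indicator_def)
    qed
    finally show "emeasure (distr \<Omega> M fst) A = emeasure M A" by simp
  qed simp
  have d2: "distr \<Omega> M' snd = M'"
  proof (rule measure_eqI)
    fix A assume "A \<in> sets (distr \<Omega> M' snd)"
    then have A[measurable]: "A \<in> sets M'" by simp
    have "emeasure (distr \<Omega> M' snd) A = emeasure \<Omega> (snd -` A \<inter> space (M \<Otimes>\<^sub>M M'))"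
      by (subst emeasure_distr) (auto simp: \<Omega>_def)
    also have "\<dots> = (\<integral>\<^sup>+\<omega>. ennreal (w (K (fst \<omega>)) (K' (snd \<omega>))) * indicator (snd -` A \<inter> space (M \<Otimes>\<^sub>M M')) \<omega> \<partial>(M \<Otimes>\<^sub>M M'))"
      unfolding \<Omega>_def by (subst emeasure_density) auto
    also have "\<dots> = (\<integral>\<^sup>+\<omega>. ennreal (w (K (fst \<omega>)) (K' (snd \<omega>))) * indicator A (snd \<omega>) \<partial>(M \<Otimes>\<^sub>M M'))"
      by (intro nn_integral_cong) (auto simp: indicator_def)
    also have "\<dots> = (\<integral>\<^sup>+y. \<integral>\<^sup>+x. ennreal (w (K x) (K' y)) * indicator A y \<partial>M \<partial>M')"
      by (subst nn_integral_snd[symmetric]) (auto simp: split_beta')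
    also have "\<dots> = (\<integral>\<^sup>+y. indicator A y \<partial>M')"
    proof (rule nn_integral_cong_AE, use ae2 AE_space in eventually_elim)
      fix y assume y: "q (K' y) \<noteq> 0" "y \<in> space M'"
      with K' have "K' y \<in> I" by (auto dest: measurable_space)
      with y inner2[of "K' y"] show "(\<integral>\<^sup>+x. ennreal (w (K x) (K' y)) * indicator A y \<partial>M) = indicator A y"
        by (simp add: indicator_def)
    qed
    finally show "emeasure (distr \<Omega> M' snd) A = emeasure M' A" by simp
  qed simp
  have fst: "fst \<in> measurable \<Omega> M" by (simp add: \<Omega>_def)
  \<comment> \<open>The total mass of \<open>\<Omega>\<close> can be read off its first marginal,
    the probability \<open>M\<close>.\<close>
  have "prob_space \<Omega>"
  proof
    have "fst -` space M \<inter> space \<Omega> = space \<Omega>"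
      using measurable_space[OF fst] by blast
    then have "emeasure \<Omega> (space \<Omega>) = emeasure (distr \<Omega> M fst) (space M)"
      by (simp add: emeasure_distr[OF fst])
    then show "emeasure \<Omega> (space \<Omega>) = 1" by (simp add: d1 M.emeasure_space_1)
  qed
  moreover have "(\<integral>\<^sup>+\<omega>. \<phi> (K (fst \<omega>)) (K' (snd \<omega>)) \<partial>\<Omega>) = (\<Sum>i\<in>I. \<Sum>j\<in>I. \<phi> i j * ennreal (c i j))" for \<phi>
  proof -
    have "(\<integral>\<^sup>+\<omega>. \<phi> (K (fst \<omega>)) (K' (snd \<omega>)) \<partial>\<Omega>)
        = (\<integral>\<^sup>+\<omega>. ennreal (w (K (fst \<omega>)) (K' (snd \<omega>))) * \<phi> (K (fst \<omega>)) (K' (snd \<omega>)) \<partial>(M \<Otimes>\<^sub>M M'))"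
      unfolding \<Omega>_def by (intro nn_integral_density meas)
    also have "\<dots> = (\<integral>\<^sup>+x. \<integral>\<^sup>+y. ennreal (w (K x) (K' y)) * \<phi> (K x) (K' y) \<partial>M' \<partial>M)"
      using M'.nn_integral_fst[OF meas[of "\<lambda>i j. ennreal (w i j) * \<phi> i j"]] by simp
    also have "\<dots> = (\<Sum>i\<in>I. (\<Sum>j\<in>I. ennreal (w i j) * \<phi> i j * ennreal (q j)) * ennreal (p i))"
      by (simp add: nn_integral_finite_valued[OF K' fin, of "\<lambda>j. ennreal (w _ j) * \<phi> _ j"]
          nn_integral_finite_valued[OF K fin, of "\<lambda>i. \<Sum>j\<in>I. ennreal (w i j) * \<phi> i j * ennreal (q j)"]
          M.emeasure_eq_measure M'.emeasure_eq_measure flip: p_def q_def)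
    also have "\<dots> = (\<Sum>i\<in>I. \<Sum>j\<in>I. \<phi> i j * ennreal (c i j))"
    proof -
      have "ennreal (w i j) * \<phi> i j * ennreal (q j) * ennreal (p i) = \<phi> i j * ennreal (c i j)"
        if "i \<in> I" "j \<in> I" for i j
      proof -
        have "ennreal (w i j) * ennreal (q j) * ennreal (p i) = ennreal (c i j)"
          using cp[of i j] cq[of j i] that p0 q0 w0 by (auto simp: w_def simp flip: ennreal_mult'')
        moreover have "ennreal (w i j) * \<phi> i j * ennreal (q j) * ennreal (p i)
            = \<phi> i j * (ennreal (w i j) * ennreal (q j) * ennreal (p i))"
          by (simp only: mult_ac)
        ultimately show ?thesis by simp
      qed
      then show ?thesis by (simp add: sum_distrib_right)
    qed
    finally show ?thesis .
  qed
  ultimately show thesis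
    using d1 d2 by (intro that[of \<Omega>]) (auto simp: \<Omega>_def)
qed

section \<open>Norms and discrepancies on the cube\<close>

text \<open>Expansion in the standard basis. It supplies the boundedness that makes the real
  supremum in \<open>cube_diam\<close> an upper bound.\<close>

lemma is_norm_bounded:
  fixes N :: "real ^ 'n \<Rightarrow> real"
  assumes "is_norm N"
  shows "N z \<le> (\<Sum>i\<in>UNIV. \<bar>z $ i\<bar> * N (axis i 1))"
proof -
  have sum_le: "N (sum f A) \<le> (\<Sum>i\<in>A. N (f i))" if "finite A" for f :: "'n \<Rightarrow> real ^ 'n" and A
    using that
  proof (induction A)
    case empty
    have "N 0 = 0" using assms unfolding is_norm_def by blast
    then show ?case by simp
  next
    case (insert a A)
    moreover have "N (f a + sum f A) \<le> N (f a) + N (sum f A)"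
      using assms unfolding is_norm_def by blast
    ultimately show ?case by simp
  qed
  have "z = (\<Sum>i\<in>UNIV. (z $ i) *\<^sub>R axis i 1)"
    using basis_expansion[of z] by (simp add: scalar_mult_eq_scaleR)
  then have "N z \<le> (\<Sum>i\<in>UNIV. N ((z $ i) *\<^sub>R axis i 1))"
    using sum_le[of UNIV "\<lambda>i. (z $ i) *\<^sub>R axis i 1"] by simp
  also have "\<dots> = (\<Sum>i\<in>UNIV. \<bar>z $ i\<bar> * N (axis i 1))"
    using assms unfolding is_norm_def by (intro sum.cong refl) blast
  finally show ?thesis .
qed

lemma norm_diff_le_cube_diam:
  fixes N :: "real ^ 'n \<Rightarrow> real"
  assumes N: "is_norm N" and xy: "\<And>i. x $ i \<in> {0<..1}" "\<And>i. y $ i \<in> {0<..1}"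
  shows "N (y - x) \<le> cube_diam N"
  unfolding cube_diam_def
proof (rule cSup_upper)
  show "bdd_above {N (y - x) | x y. (\<forall>i. x $ i \<in> {0<..1}) \<and> (\<forall>i. y $ i \<in> {0<..1})}"
  proof (rule bdd_aboveI)
    fix t assume "t \<in> {N (y - x) | x y. (\<forall>i. x $ i \<in> {0<..1}) \<and> (\<forall>i. y $ i \<in> {0<..1})}"
    then obtain x y :: "real ^ 'n" where t: "t = N (y - x)"
      and xy: "\<And>i. x $ i \<in> {0<..1}" "\<And>i. y $ i \<in> {0<..1}" by blast
    have "t \<le> (\<Sum>i\<in>UNIV. \<bar>(y - x) $ i\<bar> * N (axis i 1))"
      unfolding t by (rule is_norm_bounded[OF N])
    also have "\<dots> \<le> (\<Sum>i\<in>UNIV. 1 * N (axis i 1))"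
    proof (intro sum_mono mult_right_mono)
      fix i :: 'n
      show "\<bar>(y - x) $ i\<bar> \<le> 1" using xy[of i] by (auto simp: abs_le_iff)
      show "0 \<le> N (axis i 1)" using N by (simp add: is_norm_def)
    qed
    finally show "t \<le> (\<Sum>i\<in>UNIV. 1 * N (axis i 1))" .
  qed
qed (use xy in blast)

lemma cube_diam_nonneg:
  fixes N :: "real ^ 'n \<Rightarrow> real"
  assumes "is_norm N" shows "0 \<le> cube_diam N"
proof -
  have "0 \<le> N (1 - 1)" using assms unfolding is_norm_def by blast
  also have "\<dots> \<le> cube_diam N" by (rule norm_diff_le_cube_diam[OF assms]) auto
  finally show ?thesis .
qed

text \<open>The half-open cube contains no pair of points at sup-distance one, hence the limit.\<close>

lemma is_norm_le_cube_diam: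
  fixes N :: "real ^ 'n \<Rightarrow> real"
  assumes N: "is_norm N" and z: "\<And>i. \<bar>z $ i\<bar> \<le> h"
  shows "N z \<le> cube_diam N * h"
proof -
  \<comment> \<open>The index type is inhabited, so some coordinate, here \<open>undefined\<close>,
    witnesses that \<open>h\<close> is nonnegative.\<close>
  have h0: "0 \<le> h" using z[of undefined] by linarith
  have scale: "N (c *\<^sub>R v) = \<bar>c\<bar> * N v" for c v using N by (simp add: is_norm_def)
  have less: "N z \<le> cube_diam N * b" if "h < b" for b
  proof -
    have b: "0 < b" using that h0 by simp
    \<comment> \<open>The positive and negative parts of \<open>z / b\<close> are subtracted from
      the corner 1, so the two points differ by \<open>z / b\<close>. Since the coordinates of
      \<open>z\<close> are strictly smaller than \<open>b\<close> in absolute value, both points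
      avoid the excluded faces.\<close>
    define x :: "real ^ 'n" where "x = (\<chi> i. 1 - max 0 (z $ i / b))"
    define y :: "real ^ 'n" where "y = (\<chi> i. 1 - max 0 (- z $ i / b))"
    have zb: "z $ i < b" "- b < z $ i" for i using z[of i] that by auto
    have "y - x = (1 / b) *\<^sub>R z"
      using b by (auto simp: vec_eq_iff x_def y_def max_def field_simps)
    moreover have "N (y - x) \<le> cube_diam N"
      by (rule norm_diff_le_cube_diam[OF N]) (use b zb in \<open>auto simp: x_def y_def max_def field_simps\<close>)
    ultimately show ?thesis using b by (simp add: scale field_simps)
  qed
  show ?thesis
  proof (rule tendsto_lowerbound)
    show "((\<lambda>b. cube_diam N * b) \<longlongrightarrow> cube_diam N * h) (at_right h)"
      by (intro tendsto_intros)
    show "\<forall>\<^sub>F b in at_right h. N z \<le> cube_diam N * b"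
      using less by (auto simp: eventually_at_right_field intro: gt_ex)
  qed simp
qed

section \<open>Measures on the cube and the comparison of the two discrepancies\<close>

lemma prob_on_cube_sets:
  assumes "prob_on_cube \<mu>" "A \<in> sets borel" "A \<subseteq> {0..1}"
  shows "A \<in> sets \<mu>"
  using assms by (auto simp: prob_on_cube_def sets_restrict_space_iff)

lemma prob_on_cube_space:
  assumes "prob_on_cube \<mu>"
  shows "space \<mu> = {0..1}"
  using sets_eq_imp_space_eq[of \<mu> "restrict_space borel {0..1}"] assms
  by (auto simp: prob_on_cube_def space_restrict_space)

text \<open>Continuity from below carries a discrepancy bound from closed boxes to the half-open
  sets that they exhaust.\<close>

lemma measure_diff_incseq_le:
  assumes "finite_measure M" "finite_measure M'" and A: "range A \<subseteq> sets M" "range A \<subseteq> sets M'" "incseq A"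
    and le: "\<And>n. \<bar>measure M (A n) - measure M' (A n)\<bar> \<le> D"
  shows "\<bar>measure M (\<Union>n. A n) - measure M' (\<Union>n. A n)\<bar> \<le> D"
proof (rule tendsto_upperbound)
  show "(\<lambda>n. \<bar>measure M (A n) - measure M' (A n)\<bar>)
      \<longlonglongrightarrow> \<bar>measure M (\<Union>n. A n) - measure M' (\<Union>n. A n)\<bar>"
    using assms by (intro tendsto_intros finite_measure.finite_Lim_measure_incseq) auto
qed (use le in auto)

lemma abs_prob_diff_le_1:
  assumes "prob_on_cube \<mu>" "prob_on_cube \<nu>"
  shows "\<bar>measure \<mu> A - measure \<nu> B\<bar> \<le> 1"
proof -
  interpret M: prob_space \<mu> using assms by (simp add: prob_on_cube_def)
  interpret M': prob_space \<nu> using assms by (simp add: prob_on_cube_def)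
  show ?thesis
    using M.prob_le_1[of A] M'.prob_le_1[of B] measure_nonneg[of \<mu> A] measure_nonneg[of \<nu> B] by linarith
qed

lemma unif_discrepancy_upper:
  fixes \<mu> \<nu> :: "(real ^ 'n) measure"
  assumes "prob_on_cube \<mu>" "prob_on_cube \<nu>" "x \<in> {0..1}" "y \<in> {0..1}"
  shows "\<bar>measure \<mu> {x..y} - measure \<nu> {x..y}\<bar> \<le> unif_discrepancy \<mu> \<nu>"
  unfolding unif_discrepancy_def
  by (rule cSup_upper) (use assms abs_prob_diff_le_1[OF assms(1,2)] in \<open>auto intro!: bdd_aboveI[of _ 1]\<close>)

lemma star_discrepancy_upper:
  fixes \<mu> \<nu> :: "(real ^ 'n) measure"
  assumes "prob_on_cube \<mu>" "prob_on_cube \<nu>" "y \<in> {0..1}"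
  shows "\<bar>measure \<mu> {0..y} - measure \<nu> {0..y}\<bar> \<le> star_discrepancy \<mu> \<nu>"
  unfolding star_discrepancy_def
  by (rule cSup_upper) (use assms abs_prob_diff_le_1[OF assms(1,2)] in \<open>auto intro!: bdd_aboveI[of _ 1]\<close>)

lemma unif_discrepancy_nonneg:
  assumes "prob_on_cube \<mu>" "prob_on_cube \<nu>"
  shows "0 \<le> unif_discrepancy \<mu> \<nu>"
  using unif_discrepancy_upper[OF assms, of 0 0] by (simp add: less_eq_vec_def)

text \<open>The lower constraints are imposed one coordinate at a time; each one is the complement of a
  constraint \<open>z\<^sub>i < x\<^sub>i\<close>, which is a limit of upper constraints.\<close>

lemma partial_box_discrepancy:
  fixes \<mu> \<nu> :: "(real ^ 'n) measure"
  assumes \<mu>: "prob_on_cube \<mu>" and \<nu>: "prob_on_cube \<nu>" and x: "x \<in> {0..1}" and fin: "finite S"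
  shows "y \<in> {0..1} \<Longrightarrow> \<bar>measure \<mu> {z \<in> {0..y}. \<forall>i\<in>S. x $ i \<le> z $ i} - measure \<nu> {z \<in> {0..y}. \<forall>i\<in>S. x $ i \<le> z $ i}\<bar>
     \<le> 2 ^ card S * star_discrepancy \<mu> \<nu>"
  using fin
proof (induction S arbitrary: y)
  case empty
  have "{z \<in> {0..y}. \<forall>i\<in>{}. x $ i \<le> z $ i} = {0..y}" by auto
  with empty show ?case using star_discrepancy_upper[OF \<mu> \<nu>, of y] by (simp only: card.empty) simp
next
  case (insert k S)
  interpret M: prob_space \<mu> using \<mu> by (simp add: prob_on_cube_def)
  interpret M': prob_space \<nu> using \<nu> by (simp add: prob_on_cube_def)
  define B where "B y = {z \<in> {0..y}. \<forall>i\<in>S. x $ i \<le> z $ i}" for y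
  have IH: "\<bar>measure \<mu> (B y) - measure \<nu> (B y)\<bar> \<le> 2 ^ card S * star_discrepancy \<mu> \<nu>" if "y \<in> {0..1}" for y
    using insert.IH[OF that] by (simp add: B_def)
  have "closed (B y)" for y
  proof -
    have "B y = {0..y} \<inter> (\<Inter>i\<in>S. {z. x $ i \<le> z $ i})" by (auto simp: B_def)
    also have "closed \<dots>"
      by (intro closed_Int closed_INT ballI closed_Collect_le continuous_intros) auto
    finally show ?thesis .
  qed
  then have B[measurable]: "B y \<in> sets borel" for y by (rule borel_closed)
  have sub: "B y \<subseteq> {0..1}" if "y \<in> {0..1}" for y
    using that by (auto simp: B_def)
  define C where "C = {z \<in> B y. z $ k < x $ k}"
  have nonneg: "0 \<le> star_discrepancy \<mu> \<nu>"
    using star_discrepancy_upper[OF \<mu> \<nu> insert.prems] by linarith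
  show ?case
  proof (cases "x $ k \<le> y $ k \<and> 0 < x $ k")
    case True
    \<comment> \<open>Lowering the upper bound in coordinate \<open>k\<close> to
      \<open>x $ k * (1 - 1 / real (Suc n))\<close> keeps the corner in the cube and approaches
      \<open>x $ k\<close> strictly from below, so the closed sets \<open>B (u n)\<close> exhaust
      \<open>C\<close>.\<close>
    define u where "u n = (\<chi> i. if i = k then x $ k * (1 - 1 / real (Suc n)) else y $ i)" for n
    have xk: "0 < x $ k" "x $ k \<le> 1" using True x by (auto simp: less_eq_vec_def)
    have u1: "u n \<in> {0..1}" for n
      using insert.prems xk by (auto simp: u_def less_eq_vec_def intro!: mult_nonneg_nonneg mult_le_one)
    have mono: "incseq (\<lambda>n. B (u n))"
    proof (rule incseq_SucI)
      fix n
      have "1 / real (Suc (Suc n)) \<le> 1 / real (Suc n)" by (simp add: frac_le)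
      then have "u n \<le> u (Suc n)" using xk
        by (auto simp: u_def less_eq_vec_def intro!: mult_left_mono)
      then show "B (u n) \<subseteq> B (u (Suc n))" by (auto simp: B_def)
    qed
    have C: "C = (\<Union>n. B (u n))"
    proof safe
      fix z assume z: "z \<in> C"
      then have "0 < 1 - z $ k / x $ k" using xk by (simp add: C_def)
      then obtain n where "inverse (real (Suc n)) < 1 - z $ k / x $ k"
        using reals_Archimedean by blast
      then have "z $ k \<le> x $ k * (1 - 1 / real (Suc n))"
        using xk by (simp add: inverse_eq_divide field_simps)
      with z have "z \<in> B (u n)"
        by (auto simp: C_def B_def u_def less_eq_vec_def)
      then show "z \<in> (\<Union>n. B (u n))" by blast
    next
      fix z n assume z: "z \<in> B (u n)"
      then have le: "z $ i \<le> u n $ i" for i by (auto simp: B_def less_eq_vec_def)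
      have "x $ k * (1 - 1 / real (Suc n)) < x $ k" using xk by simp
      moreover have "z $ k \<le> x $ k * (1 - 1 / real (Suc n))"
        using le[of k] by (simp only: u_def vec_lambda_beta simp_thms if_True)
      ultimately have "z $ k < x $ k" "z $ k \<le> y $ k" using True by linarith+
      moreover from \<open>z $ k \<le> y $ k\<close> have "z $ i \<le> y $ i" for i
        using le[of i] by (cases "i = k") (auto simp: u_def)
      ultimately show "z \<in> C" using z by (auto simp: C_def B_def less_eq_vec_def)
    qed
    have dC: "\<bar>measure \<mu> C - measure \<nu> C\<bar> \<le> 2 ^ card S * star_discrepancy \<mu> \<nu>"
      unfolding C
      by (rule measure_diff_incseq_le)
        (use mono IH[OF u1] prob_on_cube_sets[OF \<mu> B sub[OF u1]] prob_on_cube_sets[OF \<nu> B sub[OF u1]]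
          in \<open>auto intro: M.finite_measure_axioms M'.finite_measure_axioms\<close>)
    \<comment> \<open>The new set is a difference of two sets that both obey the bound for
      \<open>S\<close>; this doubles the constant.\<close>
    have "{z \<in> {0..y}. \<forall>i\<in>insert k S. x $ i \<le> z $ i} = B y - C"
      by (auto simp: B_def C_def)
    moreover have "C \<in> sets \<mu>" "C \<in> sets \<nu>" "B y \<in> sets \<mu>" "B y \<in> sets \<nu>"
      unfolding C
      using prob_on_cube_sets[OF \<mu> B sub] prob_on_cube_sets[OF \<nu> B sub] u1 insert.prems
      by (auto intro!: sets.countable_UN)
    moreover have "C \<subseteq> B y" by (auto simp: C_def)
    ultimately have "\<bar>measure \<mu> {z \<in> {0..y}. \<forall>i\<in>insert k S. x $ i \<le> z $ i} - measure \<nu> {z \<in> {0..y}. \<forall>i\<in>insert k S. x $ i \<le> z $ i}\<bar>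
        \<le> 2 * (2 ^ card S * star_discrepancy \<mu> \<nu>)"
      using dC IH[OF insert.prems] by (simp add: M.finite_measure_Diff M'.finite_measure_Diff)
    then show ?thesis using insert.hyps by simp
  next
    case False
    moreover have "0 \<le> x $ k" using x by (simp add: less_eq_vec_def)
    \<comment> \<open>Either the two constraints on coordinate \<open>k\<close> contradict each
      other, or the lower one holds automatically on the cube.\<close>
    ultimately have "y $ k < x $ k \<or> x $ k = 0" by linarith
    then show ?thesis
    proof
      assume 1: "y $ k < x $ k"
      have "{z \<in> {0..y}. \<forall>i\<in>insert k S. x $ i \<le> z $ i} = {}"
      proof safe
        fix z assume "z \<in> {0..y}" "\<forall>i\<in>insert k S. x $ i \<le> z $ i"
        then have "x $ k \<le> z $ k" "z $ k \<le> y $ k" by (auto simp: less_eq_vec_def)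
        with 1 show "z \<in> {}" by simp
      qed
      with nonneg show ?thesis by (simp only: measure_empty) simp
    next
      assume "x $ k = 0"
      then have "{z \<in> {0..y}. \<forall>i\<in>insert k S. x $ i \<le> z $ i} = B y"
        by (auto simp: B_def less_eq_vec_def)
      moreover have "(2::real) ^ card S * star_discrepancy \<mu> \<nu> \<le> 2 ^ card (insert k S) * star_discrepancy \<mu> \<nu>"
        using insert.hyps nonneg by (intro mult_right_mono) auto
      ultimately show ?thesis using IH[OF insert.prems] by simp
    qed
  qed
qed

lemma unif_discrepancy_le_star:
  fixes \<mu> \<nu> :: "(real ^ 'n) measure"
  assumes "prob_on_cube \<mu>" "prob_on_cube \<nu>"
  shows "unif_discrepancy \<mu> \<nu> \<le> 2 ^ CARD('n) * star_discrepancy \<mu> \<nu>"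
  unfolding unif_discrepancy_def
proof (rule cSup_least)
  show "{\<bar>measure \<mu> {x..y} - measure \<nu> {x..y}\<bar> | x y. x \<in> {0..1} \<and> y \<in> {0..1}} \<noteq> {}"
    by (auto simp: less_eq_vec_def intro!: exI[of _ 0])
next
  fix t assume "t \<in> {\<bar>measure \<mu> {x..y} - measure \<nu> {x..y}\<bar> | x y. x \<in> {0..1} \<and> y \<in> {0..1}}"
  then obtain x y where t: "t = \<bar>measure \<mu> {x..y} - measure \<nu> {x..y}\<bar>"
    and x: "x \<in> {0..1}" and y: "y \<in> {0..1}" by blast
  \<comment> \<open>All coordinates are constrained here, hence the exponent
    \<open>CARD('n)\<close>; the lower bound 0 follows from that by \<open>x\<close>.\<close>
  have "{x..y} = {z \<in> {0..y}. \<forall>i\<in>UNIV. x $ i \<le> z $ i}"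
    using x order_trans[of 0 x] by (auto simp flip: less_eq_vec_def)
  then show "t \<le> 2 ^ CARD('n) * star_discrepancy \<mu> \<nu>"
    using partial_box_discrepancy[OF assms x finite y, of UNIV] by (simp add: t)
qed

section \<open>The dyadic coupling\<close>

text \<open>The cells are the products of intervals \<open>(a / 2\<^sup>k, (a + 1) / 2\<^sup>k]\<close>; the truncation in \<^const>\<open>nat\<close>
  adds the point \<open>0\<close> to the first interval.\<close>

definition dyadic_index :: "nat \<Rightarrow> real ^ 'n \<Rightarrow> 'n \<Rightarrow> nat" where
  "dyadic_index k x l = nat (\<lceil>2 ^ k * x $ l\<rceil> - 1)"

lemma nat_ceiling_minus_one_eq_iff:
  fixes y :: real
  assumes "0 \<le> y"
  shows "nat (\<lceil>y\<rceil> - 1) = a \<longleftrightarrow> (a = 0 \<or> real a < y) \<and> y \<le> real a + 1"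
proof -
  have "0 \<le> \<lceil>y\<rceil>" using assms by linarith
  have "nat (\<lceil>y\<rceil> - 1) = a \<longleftrightarrow> (a = 0 \<or> int a < \<lceil>y\<rceil>) \<and> \<lceil>y\<rceil> \<le> int a + 1"
    using \<open>0 \<le> \<lceil>y\<rceil>\<close> by linarith
  also have "int a < \<lceil>y\<rceil> \<longleftrightarrow> real a < y"
    by (simp add: less_ceiling_iff)
  also have "\<lceil>y\<rceil> \<le> int a + 1 \<longleftrightarrow> y \<le> real a + 1"
    by (simp add: ceiling_le_iff)
  finally show ?thesis .
qed

lemma dyadic_index_eq_iff:
  assumes "x \<in> {0..1}"
  shows "dyadic_index k x l = a \<longleftrightarrow> (a = 0 \<or> real a / 2 ^ k < x $ l) \<and> x $ l \<le> (real a + 1) / 2 ^ k"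
proof -
  have "0 \<le> 2 ^ k * x $ l" using assms by (simp add: less_eq_vec_def)
  from nat_ceiling_minus_one_eq_iff[OF this] show ?thesis
    by (simp add: dyadic_index_def field_simps)
qed

lemma dyadic_index_less:
  assumes "x \<in> {0..1}"
  shows "dyadic_index k x l < 2 ^ k"
proof -
  have "2 ^ k * x $ l \<le> 2 ^ k * 1"
    using assms by (intro mult_left_mono) (auto simp: less_eq_vec_def)
  then have "\<lceil>2 ^ k * x $ l\<rceil> \<le> 2 ^ k" by (simp add: ceiling_le_iff)
  then show ?thesis by (simp add: dyadic_index_def nat_less_iff)
qed

text \<open>This is the nesting of the partitions: passing to a coarser level is integer division of
  the labels, because left-open intervals split into left-open intervals. The label
  \<open>a = 0\<close> is treated apart since its interval also contains 0.\<close>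

lemma dyadic_index_div:
  assumes x: "x \<in> {0..1}"
  shows "dyadic_index (k + m) x l div 2 ^ m = dyadic_index k x l"
proof -
  define a where "a = dyadic_index (k + m) x l"
  define b where "b = a div 2 ^ m"
  have a: "a = 0 \<or> real a / 2 ^ (k + m) < x $ l" "x $ l \<le> (real a + 1) / 2 ^ (k + m)"
    using dyadic_index_eq_iff[OF x, of "k + m" l a] by (auto simp: a_def)
  have ba: "b * 2 ^ m \<le> a" by (simp add: b_def)
  then have "real (b * 2 ^ m) \<le> real a" by (simp only: of_nat_le_iff)
  from divide_right_mono[OF this, of "2 ^ (k + m)"]
  have ba': "real b / 2 ^ k \<le> real a / 2 ^ (k + m)"
    by (simp add: power_add)
  have "a < (b + 1) * 2 ^ m"
    using dividend_less_div_times[of "2 ^ m" a] by (simp add: b_def)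
  then have "real (a + 1) \<le> real ((b + 1) * 2 ^ m)" by (simp only: of_nat_le_iff)
  then have "real a + 1 \<le> (real b + 1) * 2 ^ m" by (simp add: algebra_simps)
  then have "(real a + 1) / 2 ^ (k + m) \<le> (real b + 1) * 2 ^ m / 2 ^ (k + m)"
    by (rule divide_right_mono) simp
  also have "\<dots> = (real b + 1) / 2 ^ k" by (simp add: power_add)
  finally have ab: "(real a + 1) / 2 ^ (k + m) \<le> (real b + 1) / 2 ^ k" .
  have "b = 0 \<or> real b / 2 ^ k < x $ l"
  proof (cases "a = 0")
    case False
    with a(1) ba' show ?thesis by auto
  qed (simp add: b_def)
  moreover have "x $ l \<le> (real b + 1) / 2 ^ k" using a(2) ab by linarith
  ultimately have "dyadic_index k x l = b" by (simp add: dyadic_index_eq_iff[OF x])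
  then show ?thesis by (simp add: a_def b_def)
qed

lemma dyadic_index_eq_imp_close:
  assumes x: "x \<in> {0..1}" and y: "y \<in> {0..1}" and eq: "dyadic_index k x l = dyadic_index k y l"
  shows "\<bar>x $ l - y $ l\<bar> \<le> 1 / 2 ^ k"
proof -
  define a where "a = dyadic_index k y l"
  have lower: "real a / 2 ^ k \<le> z $ l" and upper: "z $ l \<le> (real a + 1) / 2 ^ k"
    if "z \<in> {0..1}" "dyadic_index k z l = a" for z
    using that dyadic_index_eq_iff[of z k l a] by (auto simp: less_eq_vec_def)
  have "dyadic_index k x l = a" "dyadic_index k y l = a" using eq by (simp_all add: a_def)
  then have "real a / 2 ^ k \<le> x $ l" "x $ l \<le> (real a + 1) / 2 ^ k"
      "real a / 2 ^ k \<le> y $ l" "y $ l \<le> (real a + 1) / 2 ^ k"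
    using lower upper x y by blast+
  moreover have "(real a + 1) / 2 ^ k = real a / 2 ^ k + 1 / 2 ^ k" by (simp add: add_divide_distrib)
  ultimately show ?thesis by linarith
qed

text \<open>The discrepancy speaks of closed boxes, while the cells are open on the left. Moving the
  lower faces inwards by \<open>1 / real (Suc n)\<close> of the side gives closed boxes that exhaust
  the cell; faces with label 0 stay in place because 0 belongs to the first interval.\<close>

lemma dyadic_cell_eq_Union:
  fixes g :: "'n::finite \<Rightarrow> nat"
  assumes g: "\<And>l. g l < 2 ^ k"
  defines "lo \<equiv> \<lambda>n. \<chi> l. if g l = 0 then 0 else (real (g l) + 1 / real (Suc n)) / 2 ^ k"
    and "hi \<equiv> \<chi> l. (real (g l) + 1) / 2 ^ k"
  shows "lo n \<in> {0..1}" and "hi \<in> {0..1 :: real ^ 'n}" and "incseq (\<lambda>n. {lo n..hi})"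
    and "{x \<in> {0..1}. dyadic_index k x = g} = (\<Union>n. {lo n..hi})"
proof -
  have g1: "(real (g l) + 1) / 2 ^ k \<le> 1" for l
  proof -
    have "real (g l + 1) \<le> real (2 ^ k)" using g[of l] by (simp only: of_nat_le_iff)
    then show ?thesis by simp
  qed
  show hi: "hi \<in> {0..1}" using g1 by (auto simp: hi_def less_eq_vec_def)
  have lohi: "lo n \<le> hi" for n
    by (auto simp: lo_def hi_def less_eq_vec_def divide_right_mono)
  have lo0: "0 \<le> lo n" for n by (auto simp: lo_def less_eq_vec_def)
  show "lo n \<in> {0..1}" using lo0 lohi[of n] hi by (auto intro: order_trans)
  have "lo (Suc n) \<le> lo n" for n
    by (auto simp: lo_def less_eq_vec_def intro!: divide_right_mono frac_le)
  then show "incseq (\<lambda>n. {lo n..hi})"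
    by (intro incseq_SucI) (auto intro: order_trans)
  show "{x \<in> {0..1}. dyadic_index k x = g} = (\<Union>n. {lo n..hi})"
  proof safe
    fix x :: "real ^ 'n" assume x: "x \<in> {0..1}" and "g = dyadic_index k x"
    then have gx: "g l = 0 \<or> real (g l) / 2 ^ k < x $ l" "x $ l \<le> (real (g l) + 1) / 2 ^ k" for l
      using dyadic_index_eq_iff[OF x, of k l "g l"] by auto
    \<comment> \<open>Each coordinate passes eventually; as there are finitely many coordinates, one
      \<open>n\<close> serves them all.\<close>
    have "\<forall>\<^sub>F n in sequentially. (\<chi> l. if g l = 0 then 0 else (real (g l) + 1 / real (Suc n)) / 2 ^ k) $ l \<le> x $ l" for l
    proof (cases "g l = 0")
      case True
      then show ?thesis using x by (simp add: less_eq_vec_def)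
    next
      case False
      then have "real (g l) < 2 ^ k * x $ l" using gx(1)[of l] by (simp add: field_simps)
      moreover have "(\<lambda>n. real (g l) + 1 / real (Suc n)) \<longlonglongrightarrow> real (g l) + 0"
        by (intro tendsto_intros LIMSEQ_Suc lim_1_over_n)
      ultimately have "\<forall>\<^sub>F n in sequentially. real (g l) + 1 / real (Suc n) < 2 ^ k * x $ l"
        by (intro order_tendstoD) auto
      then show ?thesis
        by eventually_elim (use False in \<open>simp add: pos_divide_le_eq mult.commute less_imp_le\<close>)
    qed
    then have "\<forall>\<^sub>F n in sequentially. \<forall>l. lo n $ l \<le> x $ l"
      unfolding lo_def by (intro eventually_all_finite)
    from eventually_happens'[OF sequentially_bot this] obtain n where "\<forall>l. lo n $ l \<le> x $ l"
      by blast
    with gx(2) have "x \<in> {lo n..hi}" by (auto simp: less_eq_vec_def hi_def)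
    then show "x \<in> (\<Union>n. {lo n..hi})" by blast
  next
    fix x n assume x: "x \<in> {lo n..hi}"
    with lo0[of n] hi have x01: "x \<in> {0..1}" by (auto intro: order_trans)
    have "dyadic_index k x l = g l" for l
    proof -
      have "x $ l \<le> (real (g l) + 1) / 2 ^ k" "lo n $ l \<le> x $ l"
        using x by (auto simp: less_eq_vec_def hi_def)
      moreover have "real (g l) / 2 ^ k < lo n $ l" if "g l \<noteq> 0"
        using that by (simp add: lo_def divide_strict_right_mono)
      ultimately show ?thesis
        unfolding dyadic_index_eq_iff[OF x01] by force
    qed
    then show "dyadic_index k x = g" by blast
    show "x \<in> {0..1}" by fact
  qed
qed

lemma dyadic_cell_borel:
  fixes g :: "'n::finite \<Rightarrow> nat"
  assumes "\<And>l. g l < 2 ^ k"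
  shows "{x \<in> {0..1 :: real ^ 'n}. dyadic_index k x = g} \<in> sets borel"
  unfolding dyadic_cell_eq_Union(4)[OF assms] by auto

lemma dyadic_cell_discrepancy:
  fixes \<mu> \<nu> :: "(real ^ 'n) measure"
  assumes \<mu>: "prob_on_cube \<mu>" and \<nu>: "prob_on_cube \<nu>" and g: "\<And>l. g l < 2 ^ k"
  shows "\<bar>measure \<mu> {x \<in> {0..1}. dyadic_index k x = g} - measure \<nu> {x \<in> {0..1}. dyadic_index k x = g}\<bar>
    \<le> unif_discrepancy \<mu> \<nu>"
proof -
  interpret M: prob_space \<mu> using \<mu> by (simp add: prob_on_cube_def)
  interpret M': prob_space \<nu> using \<nu> by (simp add: prob_on_cube_def)
  have sub: "{x..y} \<subseteq> {0..1}" if "x \<in> {0..1}" "y \<in> {0..1}" for x y :: "real ^ 'n"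
    using that by auto
  show ?thesis
    unfolding dyadic_cell_eq_Union(4)[OF g]
  proof (rule measure_diff_incseq_le)
    show "range (\<lambda>n. {\<chi> l. if g l = 0 then 0 else (real (g l) + 1 / real (Suc n)) / 2 ^ k..
        \<chi> l. (real (g l) + 1) / 2 ^ k}) \<subseteq> sets \<mu>"
      by (intro image_subsetI prob_on_cube_sets[OF \<mu>] sub dyadic_cell_eq_Union(1,2)[OF g]) simp
    show "range (\<lambda>n. {\<chi> l. if g l = 0 then 0 else (real (g l) + 1 / real (Suc n)) / 2 ^ k..
        \<chi> l. (real (g l) + 1) / 2 ^ k}) \<subseteq> sets \<nu>"
      by (intro image_subsetI prob_on_cube_sets[OF \<nu>] sub dyadic_cell_eq_Union(1,2)[OF g]) simp
  qed (intro M.finite_measure_axioms M'.finite_measure_axioms dyadic_cell_eq_Union(3)[OF g]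
      unif_discrepancy_upper[OF \<mu> \<nu>] dyadic_cell_eq_Union(1,2)[OF g])+
qed

text \<open>The target is finite and discrete, so Borel fibres suffice. Written as
  \<open>\<rightarrow>\<^sub>E\<close> over \<open>UNIV\<close>, the label set comes with its
  finiteness and its cardinality \<open>(2 ^ k) ^ CARD('n)\<close>.\<close>

lemma measurable_dyadic_index:
  fixes \<mu> :: "(real ^ 'n) measure"
  assumes \<mu>: "prob_on_cube \<mu>"
  shows "dyadic_index k \<in> measurable \<mu> (count_space (UNIV \<rightarrow>\<^sub>E {..<2 ^ k}))"
proof (subst measurable_count_space_eq2)
  show "finite (UNIV \<rightarrow>\<^sub>E {..<2 ^ k} :: ('n \<Rightarrow> nat) set)" by (intro finite_PiE) auto
  show "dyadic_index k \<in> space \<mu> \<rightarrow> (UNIV \<rightarrow>\<^sub>E {..<2 ^ k})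
    \<and> (\<forall>a\<in>UNIV \<rightarrow>\<^sub>E {..<2 ^ k}. dyadic_index k -` {a} \<inter> space \<mu> \<in> sets \<mu>)"
  proof (intro conjI ballI)
    show "dyadic_index k \<in> space \<mu> \<rightarrow> (UNIV \<rightarrow>\<^sub>E {..<2 ^ k})"
      by (auto simp: prob_on_cube_space[OF \<mu>] intro!: dyadic_index_less)
  next
    fix a :: "'n \<Rightarrow> nat" assume "a \<in> UNIV \<rightarrow>\<^sub>E {..<2 ^ k}"
    then have "{x \<in> {0..1}. dyadic_index k x = a} \<in> sets \<mu>"
      by (intro prob_on_cube_sets[OF \<mu>] dyadic_cell_borel) (auto simp: PiE_iff)
    moreover have "dyadic_index k -` {a} \<inter> space \<mu> = {x \<in> {0..1}. dyadic_index k x = a}"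
      by (auto simp: prob_on_cube_space[OF \<mu>])
    ultimately show "dyadic_index k -` {a} \<inter> space \<mu> \<in> sets \<mu>" by simp
  qed
qed

section \<open>Transport cost of the dyadic coupling\<close>

lemma sum_measure_fibres:
  assumes "finite_measure M" and K: "K \<in> measurable M (count_space I)" and "finite J" "J \<subseteq> I"
  shows "(\<Sum>i\<in>J. measure M (K -` {i} \<inter> space M)) = measure M (K -` J \<inter> space M)"
proof -
  have "K -` J \<inter> space M = (\<Union>i\<in>J. K -` {i} \<inter> space M)" by blast
  moreover have "disjoint_family_on (\<lambda>i. K -` {i} \<inter> space M) J"
    by (auto simp: disjoint_family_on_def)
  moreover have "(\<lambda>i. K -` {i} \<inter> space M) ` J \<subseteq> sets M"
    using assms(4) measurable_sets[OF K] by auto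
  ultimately show ?thesis
    using finite_measure.finite_measure_finite_Union[OF assms(1,3), of "\<lambda>i. K -` {i} \<inter> space M"]
    by (simp only:)
qed

text \<open>A telescoping sum: \<open>2\<^sup>-\<^sup>k = 2\<^sup>-\<^sup>L + \<Sum>\<close> of \<open>2\<^sup>-\<^sup>m\<close> for \<open>m\<close> from \<open>k + 1\<close> to \<open>L\<close>, which makes the cost
  additive in the levels that separate two points.\<close>

lemma le_sum_separating_levels:
  fixes t :: real
  assumes "P 0" and "\<And>k. k \<le> L \<Longrightarrow> P k \<Longrightarrow> t \<le> 1 / 2 ^ k"
  shows "t \<le> 1 / 2 ^ L + (\<Sum>k\<in>{1..L}. 1 / 2 ^ k * of_bool (\<not> P k))"
  using assms(2)
proof (induction L)
  case 0
  then show ?case using assms(1) by simp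
next
  case (Suc L)
  have IH: "t \<le> 1 / 2 ^ L + (\<Sum>k\<in>{1..L}. 1 / 2 ^ k * of_bool (\<not> P k))"
    by (rule Suc.IH) (use Suc.prems in auto)
  show ?case
  \<comment> \<open>If level \<open>Suc L\<close> separates, the new summand
    \<open>1 / 2 ^ Suc L\<close> makes up exactly for replacing \<open>1 / 2 ^ L\<close> by
    \<open>1 / 2 ^ Suc L\<close>.\<close>
  proof (cases "P (Suc L)")
    case True
    with Suc.prems have "t \<le> 1 / 2 ^ Suc L" by blast
    moreover have "0 \<le> (\<Sum>k\<in>{1..Suc L}. 1 / 2 ^ k * of_bool (\<not> P k) :: real)"
      by (intro sum_nonneg) simp
    ultimately show ?thesis by linarith
  qed (use IH in simp)
qed

text \<open>In dimension d, level \<open>k\<close> has at most 2^(dk) cells, so at most half of that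
  times the discrepancy crosses them; the weight \<open>1 / 2 ^ k\<close> lowers the exponent to (d
  - 1)k. Level 0 never separates points, so the sum starts at 1.\<close>

lemma wasserstein1_dyadic_bound:
  fixes N :: "real ^ 'n \<Rightarrow> real" and \<mu> \<nu> :: "(real ^ 'n) measure"
  assumes N: "is_norm N" and \<mu>: "prob_on_cube \<mu>" and \<nu>: "prob_on_cube \<nu>"
  shows "wasserstein1 N \<mu> \<nu> \<le> ennreal (cube_diam N *
    (1 / 2 ^ L + unif_discrepancy \<mu> \<nu> / 2 * (\<Sum>k\<in>{1..L}. (2 ^ (CARD('n) - 1)) ^ k)))"
proof -
  interpret M: prob_space \<mu> using \<mu> by (simp add: prob_on_cube_def)
  interpret M': prob_space \<nu> using \<nu> by (simp add: prob_on_cube_def)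
  define D where "D = unif_discrepancy \<mu> \<nu>"
  define I where "I = (UNIV \<rightarrow>\<^sub>E {..<2 ^ L} :: ('n \<Rightarrow> nat) set)"
  define K :: "real ^ 'n \<Rightarrow> 'n \<Rightarrow> nat" where "K = dyadic_index L"
  \<comment> \<open>Labels are halved \<open>m\<close> times, so \<open>m\<close> counts from the
    finest partition upwards, and dyadic level \<open>k\<close> corresponds to
    \<open>m = L - k\<close>.\<close>
  define e :: "nat \<Rightarrow> ('n \<Rightarrow> nat) \<Rightarrow> 'n \<Rightarrow> nat" where "e m f = (\<lambda>l. f l div 2 ^ m)" for m f
  define p where "p i = measure \<mu> (K -` {i} \<inter> space \<mu>)" for i
  define q where "q i = measure \<nu> (K -` {i} \<inter> space \<nu>)" for i
  have fin: "finite I" unfolding I_def by (intro finite_PiE) auto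
  have K\<mu>: "K \<in> measurable \<mu> (count_space I)" and K\<nu>: "K \<in> measurable \<nu> (count_space I)"
    using measurable_dyadic_index[OF \<mu>, of L] measurable_dyadic_index[OF \<nu>, of L] by (simp_all add: K_def I_def)
  have eK: "e (L - k) (K x) = dyadic_index k x" if "x \<in> {0..1}" "k \<le> L" for x k
    using dyadic_index_div[OF that(1), of k "L - k"] that(2) by (auto simp: e_def K_def)
  have cell: "(\<Sum>i | i \<in> I \<and> e (L - k) i = g. measure \<xi> (K -` {i} \<inter> space \<xi>)) = measure \<xi> {x \<in> {0..1}. dyadic_index k x = g}"
    if "prob_on_cube \<xi>" "k \<le> L" for g k and \<xi> :: "(real ^ 'n) measure"
  proof -
    have "finite_measure \<xi>" using that(1) by (auto simp: prob_on_cube_def intro: prob_space.finite_measure)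
    moreover have K\<xi>: "K \<in> measurable \<xi> (count_space I)"
      using measurable_dyadic_index[OF that(1), of L] by (simp add: K_def I_def)
    ultimately have "(\<Sum>i | i \<in> I \<and> e (L - k) i = g. measure \<xi> (K -` {i} \<inter> space \<xi>))
        = measure \<xi> (K -` {i \<in> I. e (L - k) i = g} \<inter> space \<xi>)"
      using fin by (intro sum_measure_fibres[where I = I]) auto
    also have "K -` {i \<in> I. e (L - k) i = g} \<inter> space \<xi> = {x \<in> {0..1}. dyadic_index k x = g}"
      using eK[OF _ that(2)] measurable_space[OF K\<xi>] by (auto simp: prob_on_cube_space[OF that(1)])
    finally show ?thesis .
  qed
  have "sum p I = 1" "sum q I = 1"
  proof -
    have "K -` I \<inter> space \<mu> = space \<mu>" "K -` I \<inter> space \<nu> = space \<nu>"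
      using measurable_space[OF K\<mu>] measurable_space[OF K\<nu>] by auto
    then show "sum p I = 1" "sum q I = 1"
      unfolding p_def q_def
      using sum_measure_fibres[OF M.finite_measure_axioms K\<mu> fin] sum_measure_fibres[OF M'.finite_measure_axioms K\<nu> fin]
      by (simp_all add: M.prob_space M'.prob_space)
  qed
  obtain c where c0: "\<And>i j. 0 \<le> c i j"
    and row: "\<And>i. i \<in> I \<Longrightarrow> (\<Sum>j\<in>I. c i j) = p i" and col: "\<And>j. j \<in> I \<Longrightarrow> (\<Sum>i\<in>I. c i j) = q j"
    and split: "\<And>m. m \<le> L \<Longrightarrow> (\<Sum>i\<in>I. \<Sum>j\<in>I. c i j * of_bool (e m i \<noteq> e m j))
       \<le> (\<Sum>g\<in>e m ` I. \<bar>(\<Sum>i | i \<in> I \<and> e m i = g. p i) - (\<Sum>i | i \<in> I \<and> e m i = g. q i)\<bar>) / 2"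
  proof (rule hierarchical_coupling[OF fin, of p q e L])
    fix m i j assume "e m i = e m j"
    moreover have "e (Suc m) f = (\<lambda>l. e m f l div 2)" for f
      by (simp add: e_def mult.commute flip: div_mult2_eq)
    ultimately show "e (Suc m) i = e (Suc m) j" by simp
  next
    \<comment> \<open>Labels below \<open>2 ^ L\<close> all become 0 after division by
      \<open>2 ^ L\<close>: the coarsest partition is a single cell.\<close>
    fix i j assume "i \<in> I" "j \<in> I"
    then have "i l < 2 ^ L" "j l < 2 ^ L" for l by (auto simp: I_def PiE_iff)
    then show "e L i = e L j" by (auto simp: e_def)
  qed (use \<open>sum p I = 1\<close> \<open>sum q I = 1\<close> in \<open>auto simp: p_def q_def\<close>)
  have split': "(\<Sum>i\<in>I. \<Sum>j\<in>I. c i j * of_bool (e (L - k) i \<noteq> e (L - k) j)) \<le> (2 ^ k) ^ CARD('n) * D / 2"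
    if "k \<le> L" for k
  proof -
    have sub: "e (L - k) ` I \<subseteq> UNIV \<rightarrow>\<^sub>E {..<2 ^ k}"
    proof (intro image_subsetI)
      fix i assume "i \<in> I"
      then have "i l < 2 ^ k * 2 ^ (L - k)" for l
        using that by (auto simp: I_def PiE_iff simp flip: power_add)
      then show "e (L - k) i \<in> UNIV \<rightarrow>\<^sub>E {..<2 ^ k}"
        by (auto simp: e_def PiE_iff less_mult_imp_div_less)
    qed
    have "(\<Sum>i\<in>I. \<Sum>j\<in>I. c i j * of_bool (e (L - k) i \<noteq> e (L - k) j))
        \<le> (\<Sum>g\<in>e (L - k) ` I. \<bar>(\<Sum>i | i \<in> I \<and> e (L - k) i = g. p i) - (\<Sum>i | i \<in> I \<and> e (L - k) i = g. q i)\<bar>) / 2"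
      by (rule split) simp
    also have "(\<Sum>g\<in>e (L - k) ` I. \<bar>(\<Sum>i | i \<in> I \<and> e (L - k) i = g. p i) - (\<Sum>i | i \<in> I \<and> e (L - k) i = g. q i)\<bar>)
        \<le> of_nat (card (e (L - k) ` I)) * D"
    proof (rule sum_bounded_above)
      fix g assume "g \<in> e (L - k) ` I"
      with sub have "\<And>l. g l < 2 ^ k" by (auto simp: PiE_iff)
      then show "\<bar>(\<Sum>i | i \<in> I \<and> e (L - k) i = g. p i) - (\<Sum>i | i \<in> I \<and> e (L - k) i = g. q i)\<bar> \<le> D"
        unfolding p_def q_def cell[OF \<mu> that] cell[OF \<nu> that] D_def
        by (rule dyadic_cell_discrepancy[OF \<mu> \<nu>])
    qed
    also have "\<dots> \<le> (2 ^ k) ^ CARD('n) * D"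
    proof (rule mult_right_mono)
      have "card (e (L - k) ` I) \<le> card (UNIV \<rightarrow>\<^sub>E {..<2 ^ k} :: ('n \<Rightarrow> nat) set)"
        by (intro card_mono sub finite_PiE) auto
      also have "\<dots> = (2 ^ k) ^ CARD('n)" by (simp add: card_PiE)
      finally have "real (card (e (L - k) ` I)) \<le> real ((2 ^ k) ^ CARD('n))" by (simp only: of_nat_le_iff)
      then show "real (card (e (L - k) ` I)) \<le> (2 ^ k) ^ CARD('n)" by simp
      show "0 \<le> D" unfolding D_def by (rule unif_discrepancy_nonneg[OF \<mu> \<nu>])
    qed
    finally show ?thesis by simp
  qed
  \<comment> \<open>This cost dominates the sup-distance of points with labels \<open>i\<close> and
    \<open>j\<close>, depends on the labels only, and is affine in the separation indicators, so the
    estimates of \<open>split'\<close> can be summed over the levels.\<close>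
  define \<rho> :: "('n \<Rightarrow> nat) \<Rightarrow> ('n \<Rightarrow> nat) \<Rightarrow> real" where
    "\<rho> i j = 1 / 2 ^ L + (\<Sum>k\<in>{1..L}. 1 / 2 ^ k * of_bool (e (L - k) i \<noteq> e (L - k) j))" for i j
  have \<rho>0: "0 \<le> \<rho> i j" for i j unfolding \<rho>_def by (intro add_nonneg_nonneg sum_nonneg) auto
  have dist: "N (x - y) \<le> cube_diam N * \<rho> (K x) (K y)" if x: "x \<in> {0..1}" and y: "y \<in> {0..1}" for x y
  proof (rule is_norm_le_cube_diam[OF N])
    fix l
    show "\<bar>(x - y) $ l\<bar> \<le> \<rho> (K x) (K y)"
      unfolding \<rho>_def
    proof (rule le_sum_separating_levels[where P = "\<lambda>k. e (L - k) (K x) = e (L - k) (K y)"])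
      have "dyadic_index 0 x = dyadic_index 0 y"
        using dyadic_index_less[OF x, of 0] dyadic_index_less[OF y, of 0] by auto
      then show "e (L - 0) (K x) = e (L - 0) (K y)" using eK[OF x, of 0] eK[OF y, of 0] by simp
    next
      fix k assume "k \<le> L" and "e (L - k) (K x) = e (L - k) (K y)"
      then have "dyadic_index k x = dyadic_index k y" using eK[OF x \<open>k \<le> L\<close>] eK[OF y \<open>k \<le> L\<close>] by simp
      then show "\<bar>(x - y) $ l\<bar> \<le> 1 / 2 ^ k"
        using dyadic_index_eq_imp_close[OF x y, of k l] by simp
    qed
  qed
  obtain \<Omega> where \<Omega>: "prob_space \<Omega>" "sets \<Omega> = sets (\<mu> \<Otimes>\<^sub>M \<nu>)" "distr \<Omega> \<mu> fst = \<mu>" "distr \<Omega> \<nu> snd = \<nu>"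
    and int: "\<And>\<phi>. (\<integral>\<^sup>+\<omega>. \<phi> (K (fst \<omega>)) (K (snd \<omega>)) \<partial>\<Omega>) = (\<Sum>i\<in>I. \<Sum>j\<in>I. \<phi> i j * ennreal (c i j))"
    by (rule coupling_lift[OF M.prob_space_axioms M'.prob_space_axioms K\<mu> K\<nu> fin, of c,
          OF c0 row[unfolded p_def] col[unfolded q_def]]) (assumption | rule that)+
  \<comment> \<open>The lifted coupling already lives on a product type, as
    \<open>wasserstein1\<close> demands; the projections serve as the two random variables.\<close>
  have "wasserstein1 N \<mu> \<nu> \<le> (\<integral>\<^sup>+\<omega>. ennreal (N (fst \<omega> - snd \<omega>)) \<partial>\<Omega>)"
    unfolding wasserstein1_def
  proof (rule Inf_lower, intro CollectI exI conjI)
    show "fst \<in> measurable \<Omega> \<mu>" "snd \<in> measurable \<Omega> \<nu>"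
      by (simp_all add: measurable_cong_sets[OF \<Omega>(2) refl])
  qed (use \<Omega> in auto)
  also have "\<dots> \<le> (\<integral>\<^sup>+\<omega>. ennreal (cube_diam N * \<rho> (K (fst \<omega>)) (K (snd \<omega>))) \<partial>\<Omega>)"
  proof (intro nn_integral_mono ennreal_leI dist)
    fix \<omega> assume "\<omega> \<in> space \<Omega>"
    then have "\<omega> \<in> space \<mu> \<times> space \<nu>"
      using sets_eq_imp_space_eq[OF \<Omega>(2)] by (simp add: space_pair_measure)
    then show "fst \<omega> \<in> {0..1}" "snd \<omega> \<in> {0..1}"
      unfolding prob_on_cube_space[OF \<mu>] prob_on_cube_space[OF \<nu>] by (auto simp only: mem_Times_iff)
  qed
  also have "\<dots> = (\<Sum>i\<in>I. \<Sum>j\<in>I. ennreal (cube_diam N * \<rho> i j) * ennreal (c i j))"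
    by (rule int)
  also have "\<dots> = (\<Sum>i\<in>I. \<Sum>j\<in>I. ennreal (cube_diam N * \<rho> i j * c i j))"
    by (intro sum.cong refl ennreal_mult''[symmetric] c0)
  also have "\<dots> = ennreal (\<Sum>i\<in>I. \<Sum>j\<in>I. cube_diam N * \<rho> i j * c i j)"
    using cube_diam_nonneg[OF N] \<rho>0 c0 by (simp add: sum_ennreal sum_nonneg)
  also have "\<dots> \<le> ennreal (cube_diam N * (1 / 2 ^ L + D / 2 * (\<Sum>k\<in>{1..L}. (2 ^ (CARD('n) - 1)) ^ k)))"
  proof (rule ennreal_leI)
    have "(\<Sum>i\<in>I. \<Sum>j\<in>I. \<rho> i j * c i j)
        = 1 / 2 ^ L * (\<Sum>i\<in>I. \<Sum>j\<in>I. c i j)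
          + (\<Sum>i\<in>I. \<Sum>j\<in>I. \<Sum>k\<in>{1..L}. 1 / 2 ^ k * (c i j * of_bool (e (L - k) i \<noteq> e (L - k) j)))"
      unfolding \<rho>_def distrib_right sum.distrib sum_distrib_left sum_distrib_right
      by (simp add: mult_ac)
    also have "(\<Sum>i\<in>I. \<Sum>j\<in>I. c i j) = 1" using row \<open>sum p I = 1\<close> by simp
    also have "(\<Sum>i\<in>I. \<Sum>j\<in>I. \<Sum>k\<in>{1..L}. 1 / 2 ^ k * (c i j * of_bool (e (L - k) i \<noteq> e (L - k) j)))
        = (\<Sum>k\<in>{1..L}. 1 / 2 ^ k * (\<Sum>i\<in>I. \<Sum>j\<in>I. c i j * of_bool (e (L - k) i \<noteq> e (L - k) j)))"
    proof -
      have "(\<Sum>i\<in>I. \<Sum>j\<in>I. \<Sum>k\<in>{1..L}. 1 / 2 ^ k * (c i j * of_bool (e (L - k) i \<noteq> e (L - k) j)))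
         = (\<Sum>i\<in>I. \<Sum>k\<in>{1..L}. \<Sum>j\<in>I. 1 / 2 ^ k * (c i j * of_bool (e (L - k) i \<noteq> e (L - k) j)))"
        by (intro sum.cong refl sum.swap)
      also have "\<dots> = (\<Sum>k\<in>{1..L}. \<Sum>i\<in>I. \<Sum>j\<in>I. 1 / 2 ^ k * (c i j * of_bool (e (L - k) i \<noteq> e (L - k) j)))"
        by (rule sum.swap)
      finally show ?thesis by (simp only: sum_distrib_left)
    qed
    also have "\<dots> \<le> (\<Sum>k\<in>{1..L}. 1 / 2 ^ k * ((2 ^ k) ^ CARD('n) * D / 2))"
      by (intro sum_mono mult_left_mono split') auto
    also have "\<dots> = D / 2 * (\<Sum>k\<in>{1..L}. (2 ^ (CARD('n) - 1)) ^ k)"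
      unfolding sum_distrib_left
    proof (intro sum.cong refl)
      fix k
      have "(2 ^ k) ^ CARD('n) = (2 ^ k * (2 ^ k) ^ (CARD('n) - 1) :: real)"
        using power_eq_if[of "2 ^ k :: real" "CARD('n)"] by simp
      also have "(2 ^ k) ^ (CARD('n) - 1) = ((2 ^ (CARD('n) - 1)) ^ k :: real)"
        by (simp add: mult.commute flip: power_mult)
      finally show "1 / 2 ^ k * ((2 ^ k) ^ CARD('n) * D / 2) = D / 2 * (2 ^ (CARD('n) - 1)) ^ k"
        by simp
    qed
    finally have "(\<Sum>i\<in>I. \<Sum>j\<in>I. \<rho> i j * c i j) \<le> 1 / 2 ^ L + D / 2 * (\<Sum>k\<in>{1..L}. (2 ^ (CARD('n) - 1)) ^ k)"
      by simp
    from mult_left_mono[OF this cube_diam_nonneg[OF N]]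
    show "(\<Sum>i\<in>I. \<Sum>j\<in>I. cube_diam N * \<rho> i j * c i j)
        \<le> cube_diam N * (1 / 2 ^ L + D / 2 * (\<Sum>k\<in>{1..L}. (2 ^ (CARD('n) - 1)) ^ k))"
      by (simp add: sum_distrib_left mult.assoc)
  qed
  finally show ?thesis by (simp add: D_def)
qed

section \<open>Choice of the level\<close>

text \<open>The largest term is factored out, and \<open>1 / (1 - 1 / q)\<close> is the full
  geometric series in \<open>1 / q\<close>. For \<open>q = 2 ^ (d - 1)\<close> the denominator is
  the 1 - 2^(1-d) of the theorem.\<close>

lemma geometric_sum_le:
  fixes q :: real
  assumes "1 < q"
  shows "(\<Sum>k\<in>{1..L}. q ^ k) \<le> q ^ L / (1 - 1 / q)"
proof (induction L)
  case 0
  then show ?case using assms by simp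
next
  case (Suc L)
  have "q ^ L / (1 - 1 / q) + q ^ Suc L = q ^ Suc L / (1 - 1 / q)"
    using assms by (simp add: field_simps)
  with Suc show ?case by simp
qed

lemma ex_power_half_between:
  fixes w :: real
  assumes "0 < w" "w < 1"
  obtains L where "w \<le> (1 / 2) ^ L" "(1 / 2) ^ L < 2 * w"
proof -
  \<comment> \<open>\<open>L\<close> will be the predecessor of the first exponent whose power falls
    below \<open>w\<close>; \<open>w < 1\<close> makes that exponent positive.\<close>
  define n where "n = (LEAST n. (1 / 2) ^ n < w)"
  obtain m where "(1 / 2) ^ m < w" using real_arch_pow_inv[OF assms(1), of "1 / 2"] by auto
  then have n: "(1 / 2) ^ n < w" unfolding n_def by (rule LeastI)
  with assms have "n \<noteq> 0" by (intro notI) simp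
  then obtain L where L: "n = Suc L" using not0_implies_Suc by blast
  then have "\<not> (1 / 2) ^ L < w" unfolding n_def by (metis lessI not_less_Least)
  with n L show thesis by (intro that[of L]) auto
qed

text \<open>With u = 2^(-L) the left side is at most u + D u^(1-d) / (2s). A vanishing derivative
  means u^d = (d - 1) D / (2s), which defines the minimiser \<open>w\<close>; rounding to a dyadic u
  in [w, 2w) costs the factor two.\<close>

lemma ex_good_level:
  fixes D :: real
  assumes "2 \<le> d" and "0 < D"
  defines "s \<equiv> 1 - 2 powr (1 - real d)"
  obtains L where "1 / 2 ^ L + D / 2 * (\<Sum>k\<in>{1..L}. (2 ^ (d - 1)) ^ k)
    \<le> ((real d - 1) * D / (2 * s)) powr (1 / real d) * (2 * real d / (real d - 1))"
proof -
  define q :: real where "q = 2 ^ (d - 1)"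
  have "q = 2 powr (real d - 1)" using assms(1) by (simp add: q_def of_nat_diff flip: powr_realpow)
  then have s: "s = 1 - 1 / q" by (simp add: s_def powr_minus_divide[of 2 "real d - 1", simplified])
  have "1 < q" unfolding q_def using assms(1) by (intro one_less_power) auto
  then have s0: "0 < s" by (simp add: s)
  define w where "w = ((real d - 1) * D / (2 * s)) powr (1 / real d)"
  have base: "0 < (real d - 1) * D / (2 * s)" using assms s0 by simp
  then have w0: "0 < w" unfolding w_def powr_gt_zero by linarith
  have "w ^ d = w powr real d" using w0 by (simp add: powr_realpow)
  also have "\<dots> = ((real d - 1) * D / (2 * s)) powr 1"
    unfolding w_def powr_powr using assms(1) by simp
  also have "\<dots> = (real d - 1) * D / (2 * s)"
    by (rule powr_one[OF less_imp_le[OF base]])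
  finally have wd: "D / (2 * s) = w ^ d / (real d - 1)" using assms(1) by simp
  show thesis
  proof (cases "w < 1")
    case True
    then obtain L where L: "w \<le> (1 / 2) ^ L" "(1 / 2) ^ L < 2 * w"
      using ex_power_half_between[OF w0] by blast
    have "D / 2 * (\<Sum>k\<in>{1..L}. q ^ k) \<le> D / 2 * (q ^ L / s)"
      unfolding s using assms(2) by (intro mult_left_mono geometric_sum_le \<open>1 < q\<close>) auto
    also have "\<dots> = w ^ d / (real d - 1) * q ^ L"
      by (simp flip: wd)
    also have "\<dots> = w / (real d - 1) * (w * 2 ^ L) ^ (d - 1)"
    proof -
      have "w ^ d = w * w ^ (d - 1)" using assms(1) power_eq_if[of w d] by simp
      moreover have "q ^ L = (2 ^ L) ^ (d - 1)" by (simp add: q_def mult.commute flip: power_mult)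
      ultimately show ?thesis by (simp add: power_mult_distrib)
    qed
    \<comment> \<open>The lower bound on u = 2^(-L) says \<open>w * 2 ^ L\<close> is at most 1: the
      second term decreases in u, so it is bounded by its value at \<open>w\<close>.\<close>
    also have "\<dots> \<le> w / (real d - 1) * 1"
      using L(1) w0 assms(1) by (intro mult_left_mono power_le_one) (auto simp: power_divide field_simps)
    finally have "D / 2 * (\<Sum>k\<in>{1..L}. q ^ k) \<le> w / (real d - 1)"
      by (simp only: mult_1_right)
    moreover have "1 / 2 ^ L < 2 * w" using L(2) by (simp add: power_divide)
    ultimately have "1 / 2 ^ L + D / 2 * (\<Sum>k\<in>{1..L}. q ^ k) \<le> 2 * w + w / (real d - 1)"
      by linarith
    \<comment> \<open>Here 2 + 1/(d-1) <= 2 + 2/(d-1) = 2d/(d-1).\<close>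
    also have "\<dots> \<le> w * (2 * real d / (real d - 1))"
      using assms(1) w0 by (simp add: field_simps)
    finally show thesis using that[of L] by (simp add: q_def w_def)
  next
    case False
    \<comment> \<open>For \<open>w\<close> at least 1 the undivided cube is enough: level 0 costs 1
      and the sum over levels is empty.\<close>
    have "1 * 1 \<le> w * (2 * real d / (real d - 1))"
      using False assms(1) by (intro mult_mono) (auto simp: field_simps)
    then show thesis using that[of 0] by (simp add: w_def)
  qed
qed

section \<open>From a good level to the two discrepancy bounds\<close>

lemma wasserstein1_le_unif_discrepancy:
  fixes N :: "real ^ 'n \<Rightarrow> real" and \<mu> \<nu> :: "(real ^ 'n) measure"
  assumes d: "d = CARD('n)" "2 \<le> d" and N: "is_norm N" and \<mu>: "prob_on_cube \<mu>" and \<nu>: "prob_on_cube \<nu>"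
  shows "wasserstein1 N \<mu> \<nu> \<le>
     ennreal (cube_diam N * 2 powr (- (1 / real d))
       * (3 * (real d - 1) / (2 * (1 - 2 powr (1 - real d)))) powr (1 / real d)
       * (2 * real d / (real d - 1))
       * unif_discrepancy \<mu> \<nu> powr (1 / real d))"
proof -
  define D where "D = unif_discrepancy \<mu> \<nu>"
  define s where "s = 1 - 2 powr (1 - real d)"
  have D0: "0 \<le> D" unfolding D_def by (rule unif_discrepancy_nonneg[OF \<mu> \<nu>])
  have bound: "wasserstein1 N \<mu> \<nu> \<le> ennreal (cube_diam N *
    (1 / 2 ^ L + D / 2 * (\<Sum>k\<in>{1..L}. (2 ^ (d - 1)) ^ k)))" for L
    unfolding D_def d(1) by (rule wasserstein1_dyadic_bound[OF N \<mu> \<nu>])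
  have "2 powr (1 - real d) < 2 powr 0" using d(2) by (intro powr_less_mono) auto
  then have s0: "0 < s" by (simp add: s_def)
  show ?thesis
  proof (cases "D = 0")
    case True
    \<comment> \<open>Without discrepancy there is no positive minimiser; refining indefinitely
      sends the bound to 0.\<close>
    have "(\<lambda>L. ennreal (cube_diam N * (1 / 2) ^ L)) \<longlonglongrightarrow> ennreal (cube_diam N * 0)"
      by (intro tendsto_intros LIMSEQ_power_zero) simp
    moreover have "wasserstein1 N \<mu> \<nu> \<le> ennreal (cube_diam N * (1 / 2) ^ L)" for L
      using bound[of L] True by (simp add: power_divide)
    ultimately have "wasserstein1 N \<mu> \<nu> \<le> ennreal (cube_diam N * 0)"
      by (intro LIMSEQ_le_const) auto
    then show ?thesis by simp
  next
    case False
    with D0 have "0 < D" by simp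
    obtain L where L: "1 / 2 ^ L + D / 2 * (\<Sum>k\<in>{1..L}. (2 ^ (d - 1)) ^ k)
       \<le> ((real d - 1) * D / (2 * s)) powr (1 / real d) * (2 * real d / (real d - 1))"
      unfolding s_def by (rule ex_good_level[OF d(2) \<open>0 < D\<close>])
    have "0 \<le> (real d - 1) * D / (2 * s)" using d(2) s0 D0 by simp
    \<comment> \<open>The base in the statement is 3/2 times the base supplied by
      \<open>ex_good_level\<close>, and the power is monotone.\<close>
    moreover have "(1 / 2) * (3 * (real d - 1) / (2 * s)) * D = 3 / 2 * ((real d - 1) * D / (2 * s))"
      by simp
    ultimately have "((real d - 1) * D / (2 * s)) powr (1 / real d)
        \<le> ((1 / 2) * (3 * (real d - 1) / (2 * s)) * D) powr (1 / real d)"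
      by (intro powr_mono2) (simp, assumption, linarith)
    also have "\<dots> = (1 / 2) powr (1 / real d) * (3 * (real d - 1) / (2 * s)) powr (1 / real d) * D powr (1 / real d)"
      using d(2) s0 D0 by (simp only: powr_mult)
    also have "(1 / 2 :: real) powr (1 / real d) = 2 powr (- (1 / real d))"
      by (simp add: powr_minus powr_divide inverse_eq_divide)
    finally have "((real d - 1) * D / (2 * s)) powr (1 / real d) * (2 * real d / (real d - 1))
        \<le> 2 powr (- (1 / real d)) * (3 * (real d - 1) / (2 * s)) powr (1 / real d) * D powr (1 / real d)
          * (2 * real d / (real d - 1))"
      using d(2) by (intro mult_right_mono) auto
    from mult_left_mono[OF order_trans[OF L this] cube_diam_nonneg[OF N]]
    show ?thesis
      unfolding D_def[symmetric] s_def[symmetric]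
      by (intro order_trans[OF bound[of L]] ennreal_leI) (simp only: mult_ac)
  qed
qed

theorem theorem2p6:
  fixes N :: "real ^ 'n \<Rightarrow> real" and \<mu> \<nu> :: "(real ^ 'n) measure" and d :: nat
  assumes "d = CARD('n)" and "d \<ge> 2"
    and "is_norm N"
    and "prob_on_cube \<mu>" and "prob_on_cube \<nu>"
  shows "wasserstein1 N \<mu> \<nu> \<le>
           ennreal (cube_diam N * 2 powr (- (1 / real d))
             * (3 * (real d - 1) / (2 * (1 - 2 powr (1 - real d)))) powr (1 / real d)
             * (2 * real d / (real d - 1))
             * unif_discrepancy \<mu> \<nu> powr (1 / real d))
       \<and> wasserstein1 N \<mu> \<nu> \<le>
           ennreal (cube_diam N * kappa d * star_discrepancy \<mu> \<nu> powr (1 / real d))"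
proof
  show unif: "wasserstein1 N \<mu> \<nu> \<le>
           ennreal (cube_diam N * 2 powr (- (1 / real d))
             * (3 * (real d - 1) / (2 * (1 - 2 powr (1 - real d)))) powr (1 / real d)
             * (2 * real d / (real d - 1))
             * unif_discrepancy \<mu> \<nu> powr (1 / real d))"
    by (rule wasserstein1_le_unif_discrepancy[OF assms])
  \<comment> \<open>These factors are common to both bounds and stay fixed while one discrepancy
    replaces the other.\<close>
  define A where "A = (3 * (real d - 1) / (2 * (1 - 2 powr (1 - real d)))) powr (1 / real d) * (2 * real d / (real d - 1))"
  have star0: "0 \<le> star_discrepancy \<mu> \<nu>"
    using star_discrepancy_upper[OF assms(4,5), of 0] by (auto simp: less_eq_vec_def)
  have "unif_discrepancy \<mu> \<nu> powr (1 / real d) \<le> (2 ^ d * star_discrepancy \<mu> \<nu>) powr (1 / real d)"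
    using unif_discrepancy_le_star[OF assms(4,5)] unif_discrepancy_nonneg[OF assms(4,5)] assms(1)
    by (intro powr_mono2) auto
  \<comment> \<open>The d-th root of \<open>2 ^ d\<close> is 2, which turns the prefactor 2^(-1/d)
    into the 2^(1-1/d) of \<open>kappa\<close>.\<close>
  also have "\<dots> = 2 * star_discrepancy \<mu> \<nu> powr (1 / real d)"
    using star0 assms(2) by (simp add: powr_mult powr_powr flip: powr_realpow)
  finally have "cube_diam N * 2 powr (- (1 / real d)) * A * unif_discrepancy \<mu> \<nu> powr (1 / real d)
      \<le> cube_diam N * 2 powr (- (1 / real d)) * A * (2 * star_discrepancy \<mu> \<nu> powr (1 / real d))"
    using cube_diam_nonneg[OF assms(3)] assms(2) by (intro mult_left_mono) (auto simp: A_def)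
  also have "\<dots> = cube_diam N * kappa d * star_discrepancy \<mu> \<nu> powr (1 / real d)"
    by (simp add: kappa_def A_def powr_diff powr_minus field_simps)
  finally show "wasserstein1 N \<mu> \<nu> \<le>
           ennreal (cube_diam N * kappa d * star_discrepancy \<mu> \<nu> powr (1 / real d))"
    using unif by (auto simp: A_def mult.assoc intro: order_trans ennreal_leI)
qed

end
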